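(* Assume that $\mathbb{P}$ is $\psi$-mixing, let $t>0$, and let $\Gamma>0$ be a constant with $\mathbb{P}(A)\le e^{-\Gamma n}$ for all $n\ge1$ and $A\in\mathcal{C}_n$ (such a constant exists by $\psi$-mixing). Then for $\mathbb{P}$-almost all $\omega\in\Omega$ there exists $M(\omega)<\infty$ such that for every $n\ge M(\omega)$, $$\sup_{L\subset\mathbb{N}}\big|\mathbb{P}\{S^{A^\omega_n}_N\in L\}-P_t(L)\big|\le 16e^{-\Gamma n}\big(\ell^2nt+\gamma(n)(1+t^{-1})+t\ell^2n^4(1+\psi_0)\big)+2\wp\big(2^\ell t\psi_n+\gamma(n)e^{-\Gamma n}\big),$$ where $N=N^\omega_n=[t(\mathbb{P}(A^\omega_n))^{-\ell}]$ and $P_t(L)$ is the probability assigned to $L$ by the Poisson distribution with parameter $t$.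
   Context: $\mathbb{N}=\{0,1,2,\dots\}$, $\mathbb{N}_+=\{1,2,\dots\}$; $[x]$ is the integral part of a number $x$; $\wp(x)=xe^x$. $\mathcal{A}$ is a finite or countable alphabet with more than one element, $\Omega=\mathcal{A}^{\mathbb{N}}$, $\mathcal{F}$ is the $\sigma$-algebra generated by cylinder sets, $T$ is the left shift $(T\omega)_i=\omega_{i+1}$, and $\mathbb{P}$ is a $T$-invariant probability on $(\Omega,\mathcal{F})$ such that every cylinder $[a]=\{\omega:\omega_0=a\}$, $a\in\mathcal{A}$, has positive probability. For $0\le k\le n\le\infty$, $\mathcal{F}_{k,n}$ is the $\sigma$-algebra generated by the coordinates $\omega_i$ with $k\le i\le n$ (all $i\geq k$ if $n=\infty$). For $\sigma$-algebras $\mathcal{G},\mathcal{H}\subset\mathcal{F}$, $$\psi(\mathcal{G},\mathcal{H})=\sup\Big\{\Big|\frac{\mathbb{P}(B\cap C)}{\mathbb{P}(B)\mathbb{P}(C)}-1\Big|:B\in\mathcal{G},\,C\in\mathcal{H},\ \mathbb{P}(B)\mathbb{P}(C)\neq0\Big\},\qquad \psi_m=\sup_{n\in\mathbb{N}}\psi(\mathcal{F}_{0,n},\mathcal{F}_{n+m+1,\infty}).$$ $\mathbb{P}$ is called $\psi$-mixing if $\psi_0<\infty$ and $\psi_m\to0$ as $m\to\infty$. $\mathcal{C}_n$ is the set of all $n$-cylinders $[a_0,\dots,a_{n-1}]=\{\omega\in\Omega:\omega_i=a_i,\ 0\le i\le n-1\}$. For $\omega=(\omega_0,\omega_1,\dots)\in\Omega$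 and $n\ge1$, $A^\omega_n=[\omega_0,\dots,\omega_{n-1}]$. (For $\mathbb{P}$-almost all $\omega$ one has $\mathbb{P}(A^\omega_n)>0$ for all $n$.) $\ell\ge1$ and $q_1,\dots,q_\ell$ are positive increasing integer valued functions on $\mathbb{N}_+$ with $q_1(n)<q_2(n)<\cdots<q_\ell(n)$ for all $n\in\mathbb{N}_+$ and $\lim_{n\to\infty}(q_{i+1}(n)-q_i(n))=\infty$ for $i=1,\dots,\ell-1$. Set $$g(n)=\inf_{k\ge n}\min_{1\le i\le\ell-1}(q_{i+1}(k)-q_i(k)),\qquad \gamma(n)=\min\{k\ge0:g(k)\ge2n\}$$ (the infimum being over $k\in\mathbb{N}_+$ with $k\ge n$, and a minimum over the empty set being $+\infty$, so $\gamma(n)=0$ if $\ell=1$). For $A\in\mathcal{C}_n$: $X^A_k=\prod_{i=1}^\ell\mathbb{I}_A\circ T^{q_i(k)}$ and $S^A_N=\sum_{k=1}^NX^A_k$, where $\mathbb{I}_A$ is the indicator of $A$. *)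

theory Defs
  imports "HOL-Probability.Probability"
begin

text \<open>
  The alphabet is the type \<open>'a :: countable\<close>, and sequences over it are functions
  \<open>nat \<Rightarrow> 'a\<close>.
\<close>

definition left_shift :: "(nat \<Rightarrow> 'a) \<Rightarrow> nat \<Rightarrow> 'a" where
  "left_shift \<omega> = (\<lambda>i. \<omega> (Suc i))"

definition cylinder :: "'a list \<Rightarrow> (nat \<Rightarrow> 'a) set" where
  "cylinder as = {\<omega>. \<forall>i < length as. \<omega> i = as ! i}"

definition cylinders :: "nat \<Rightarrow> (nat \<Rightarrow> 'a) set set" where
  "cylinders n = {cylinder as | as. length as = n}"

definition cylinder_at :: "(nat \<Rightarrow> 'a) \<Rightarrow> nat \<Rightarrow> (nat \<Rightarrow> 'a) set" where
  "cylinder_at \<omega> n = cylinder (map \<omega> [0..<n])"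

definition cylinder_algebra :: "(nat \<Rightarrow> 'a) set set" where
  "cylinder_algebra = sigma_sets UNIV (\<Union>n. cylinders n)"

definition coord_algebra :: "nat \<Rightarrow> enat \<Rightarrow> (nat \<Rightarrow> 'a) set set" where
  "coord_algebra k n = sigma_sets UNIV {(\<lambda>\<omega>. \<omega> i) -` B | i B. k \<le> i \<and> enat i \<le> n}"

text \<open>The dependence coefficients may be infinite, hence the type \<^typ>\<open>ennreal\<close>.\<close>

definition psi_dep ::
  "(nat \<Rightarrow> 'a) measure \<Rightarrow> (nat \<Rightarrow> 'a) set set \<Rightarrow> (nat \<Rightarrow> 'a) set set \<Rightarrow> ennreal" where
  "psi_dep P G H =
     (SUP (B, C) \<in> {(B, C). B \<in> G \<and> C \<in> H \<and> measure P B * measure P C \<noteq> 0}.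
        ennreal \<bar>measure P (B \<inter> C) / (measure P B * measure P C) - 1\<bar>)"

definition psi :: "(nat \<Rightarrow> 'a) measure \<Rightarrow> nat \<Rightarrow> ennreal" where
  "psi P m = (SUP n. psi_dep P (coord_algebra 0 (enat n)) (coord_algebra (n + m + 1) \<infinity>))"

definition psi_mixing :: "(nat \<Rightarrow> 'a) measure \<Rightarrow> bool" where
  "psi_mixing P \<longleftrightarrow> psi P 0 < \<infinity> \<and> psi P \<longlonglongrightarrow> 0"

text \<open>
  The functions \<open>q\<^sub>1, \<dots>, q\<^sub>l\<close> on the positive integers are encoded as \<open>q i k\<close> with
  \<open>1 \<le> i \<le> l\<close> and \<open>k \<ge> 1\<close>; other values of \<open>q\<close> are never used. The truncated
  subtraction below is exact when \<open>q\<^sub>i(k) < q\<^sub>i\<^sub>+\<^sub>1(k)\<close>. For \<open>l = 1\<close> the inner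
  infimum is over the empty set, so \<open>gap\<close> is \<open>\<infinity>\<close> and \<open>gap_time\<close> is \<open>0\<close>.
\<close>

definition gap :: "nat \<Rightarrow> (nat \<Rightarrow> nat \<Rightarrow> nat) \<Rightarrow> nat \<Rightarrow> enat" where
  "gap l q n = (INF k \<in> {k. 1 \<le> k \<and> n \<le> k}. INF i \<in> {1..<l}. enat (q (i + 1) k - q i k))"

definition gap_time :: "nat \<Rightarrow> (nat \<Rightarrow> nat \<Rightarrow> nat) \<Rightarrow> nat \<Rightarrow> nat" where
  "gap_time l q n = (LEAST k. gap l q k \<ge> enat (2 * n))"

definition multi_hit ::
  "nat \<Rightarrow> (nat \<Rightarrow> nat \<Rightarrow> nat) \<Rightarrow> (nat \<Rightarrow> 'a) set \<Rightarrow> nat \<Rightarrow> (nat \<Rightarrow> 'a) \<Rightarrow> nat" where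
  "multi_hit l q A k \<omega> = (\<Prod>i = 1..l. indicator A ((left_shift ^^ q i k) \<omega>))"

definition hit_count ::
  "nat \<Rightarrow> (nat \<Rightarrow> nat \<Rightarrow> nat) \<Rightarrow> (nat \<Rightarrow> 'a) set \<Rightarrow> nat \<Rightarrow> (nat \<Rightarrow> 'a) \<Rightarrow> nat" where
  "hit_count l q A N \<omega> = (\<Sum>k = 1..N. multi_hit l q A k \<omega>)"

definition wp :: "real \<Rightarrow> real" where
  "wp x = x * exp x"

end

theory Submission imports Defs begin

text \<open>
  The Chen-Stein method with target Poisson(\<open>t\<close>) and \<open>a = P(A)\<^sup>l\<close>, applied to the indices
  \<open>k \<ge> \<gamma>(n)\<close>; the earlier ones cost at most \<open>\<gamma>(n) P(A)\<close>. The neighbourhood of \<open>k\<close> consists of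
  those \<open>j\<close> for which some \<open>q\<^sub>i(j)\<close> lies at distance less than \<open>2n\<close> from some \<open>q\<^sub>i(k)\<close>. Outside of it
  each block read by \<open>X\<^sub>k\<close> is separated by gaps of length at least \<open>n\<close> from all other blocks, on both
  sides. Removing the \<open>l\<close> blocks one at a time costs a factor within \<open>(1 + \<psi>\<^sub>n)\<^sup>2 / (1 - \<psi>\<^sub>n)\<close> and
  \<open>(1 - \<psi>\<^sub>n)\<^sup>2 / (1 + \<psi>\<^sub>n)\<close> each, hence a relative error of about \<open>3 l \<psi>\<^sub>n\<close>, which is less than
  \<open>2\<^sup>l\<^sup>+\<^sup>1 \<psi>\<^sub>n\<close> for small \<open>\<psi>\<^sub>n\<close>.

  Two distinct hits \<open>j\<close>, \<open>k\<close> force, after the last block of the earlier one, either a whole new block or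
  an overlap of \<open>A\<close> with its translate by some \<open>d < n\<close>. By Borel-Cantelli, almost surely the word
  defining \<open>A\<close> eventually has no period \<open>d\<close> with \<open>e\<^sup>\<Gamma>\<^sup>(\<^sup>n\<^sup>-\<^sup>d\<^sup>) > n\<^sup>3\<close>, so that the extra factor is
  at most \<open>n\<^sup>3 e\<^sup>-\<^sup>\<Gamma>\<^sup>n\<close>.
\<close>

subsection \<open>Poisson approximation by the Chen-Stein method\<close>

text \<open>This recursion is what makes the sums in both tail estimates and in the Stein equation
  telescope.\<close>

lemma poisson_pmf_Suc:
  assumes "t > 0"
  shows "real (Suc k) * pmf (poisson_pmf t) (Suc k) = t * pmf (poisson_pmf t) k"
proof -
  have "real (Suc k) * pmf (poisson_pmf t) (Suc k)
      = real (Suc k) * (t * t ^ k / (real (Suc k) * fact k) * exp (- t))"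
    using assms by (simp only: pmf_poisson less_imp_le fact_Suc power_Suc of_nat_mult of_nat_fact)
  then show ?thesis using assms by (simp del: of_nat_Suc)
qed

text \<open>With p the mass function, j p(j) = t p(j-1), so the sum of (t - j) p(j) over j \<le> k
  telescopes to t p(k); moreover t - k \<le> t - j there. The induction carries this out, whatever
  the sign of t - k.\<close>

lemma poisson_lower_tail:
  assumes "t > 0"
  shows "(t - real k) * measure (poisson_pmf t) {..k} \<le> t * pmf (poisson_pmf t) k"
proof (induction k)
  case 0
  have "{..0::nat} = {0}" by auto
  then show ?case by (simp add: measure_pmf_single)
next
  case (Suc k)
  let ?b = "measure (poisson_pmf t) {..k}" and ?p = "pmf (poisson_pmf t)"
  have b: "measure (poisson_pmf t) {..Suc k} = ?b + ?p (Suc k)"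
    by (simp add: measure_measure_pmf_finite)
  have "(t - real (Suc k)) * (?b + ?p (Suc k))
      = (t - real k) * ?b - ?b + t * ?p (Suc k) - t * ?p k"
    using poisson_pmf_Suc[OF assms, of k] by (simp add: algebra_simps)
  also have "\<dots> \<le> t * ?p (Suc k)" using Suc.IH measure_nonneg[of "poisson_pmf t" "{..k}"] by linarith
  finally show ?case unfolding b .
qed

text \<open>The counterpart for j > k: the terms (j - t) p(j) = t p(j-1) - t p(j) telescope, and k +
  1 - t \<le> j - t.\<close>

lemma poisson_upper_tail:
  assumes "t > 0"
  shows "(real k + 1 - t) * measure (poisson_pmf t) {k<..} \<le> t * pmf (poisson_pmf t) k"
proof -
  let ?b = "\<lambda>k. measure (poisson_pmf t) {..k}" and ?p = "pmf (poisson_pmf t)"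
  have b: "?b (Suc m) = ?b m + ?p (Suc m)" for m
    by (simp add: measure_measure_pmf_finite)
  \<comment> \<open>The truncated tail k < j \<le> k + m comes first; afterwards m tends to
    infinity, by continuity from below.\<close>
  have fin: "(real k + 1 - t) * (?b (k + m) - ?b k) \<le> t * (?p k - ?p (k + m))" for m
  proof (induction m)
    case (Suc m)
    have "(real k + 1) * ?p (Suc (k + m)) \<le> real (Suc (k + m)) * ?p (Suc (k + m))"
      by (intro mult_right_mono) auto
    then have "(real k + 1 - t) * ?p (Suc (k + m)) \<le> t * ?p (k + m) - t * ?p (Suc (k + m))"
      using poisson_pmf_Suc[OF assms, of "k + m"] unfolding left_diff_distrib by linarith
    then show ?case using Suc.IH b[of "k + m"] by (simp add: algebra_simps del: pmf_poisson)
  qed auto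
  have lim: "(\<lambda>m. ?b (k + m)) \<longlonglongrightarrow> measure (poisson_pmf t) (\<Union>m. {..k + m})"
    by (rule measure_pmf.finite_Lim_measure_incseq) (auto simp: incseq_def)
  have "(\<Union>m. {..k + m}) = UNIV" by auto
  with lim have "(\<lambda>m. ?b (k + m)) \<longlonglongrightarrow> 1" by simp
  then have "(\<lambda>m. (real k + 1 - t) * (?b (k + m) - ?b k)) \<longlonglongrightarrow> (real k + 1 - t) * (1 - ?b k)"
    by (intro tendsto_intros)
  moreover have "(real k + 1 - t) * (?b (k + m) - ?b k) \<le> t * ?p k" for m
  proof -
    have "t * (?p k - ?p (k + m)) \<le> t * ?p k"
      using assms by (intro mult_left_mono) (auto simp del: pmf_poisson)
    then show ?thesis using fin[of m] by linarith
  qed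
  ultimately have "(real k + 1 - t) * (1 - ?b k) \<le> t * ?p k"
    by (intro LIMSEQ_le_const2) auto
  moreover have "measure (poisson_pmf t) {k<..} = 1 - ?b k"
    using measure_pmf.prob_compl[of "{..k}" "poisson_pmf t"]
    by (simp add: Compl_eq_Diff_UNIV[symmetric])
  ultimately show ?thesis by simp
qed

text \<open>
  The bound \<open>\<bar>f\<bar> \<le> 1\<close> comes from adding the two tail estimates, whose weights satisfy
  \<open>(k + 1 - t) + (t - k) = 1\<close>.
\<close>

lemma poisson_stein_solution:
  fixes L :: "nat set"
  assumes t: "t > 0"
  obtains f :: "nat \<Rightarrow> real"
  where "\<And>k. \<bar>f k\<bar> \<le> 1"
    and "\<And>k. t * f (Suc k) - real k * f k = indicator L k - measure (poisson_pmf t) L"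
proof -
  let ?M = "measure_pmf (poisson_pmf t)" and ?p = "pmf (poisson_pmf t)"
  \<comment> \<open>Multiplied by p(k), the Stein equation telescopes: t p(k) f(k+1) equals
    \<open>F k\<close>, the sum of (1_L(j) - P(L)) p(j) over j \<le> k. The value of f at 0 is
    arbitrary, since the equation multiplies it by 0; here it is 0.\<close>
  define F where "F k = measure ?M (L \<inter> {..k}) - measure ?M L * measure ?M {..k}" for k
  define f where "f k = (case k of 0 \<Rightarrow> 0 | Suc k \<Rightarrow> F k / (t * ?p k))" for k
  have pos: "?p k > 0" for k using t by simp
  have bound: "\<bar>F k\<bar> \<le> t * ?p k" for k
  proof -
    let ?a = "measure ?M {k<..}" and ?b = "measure ?M {..k}"
    let ?x = "measure ?M (L \<inter> {..k})" and ?y = "measure ?M (L \<inter> {k<..})"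
    have ab: "?a = 1 - ?b"
      using measure_pmf.prob_compl[of "{..k}" "poisson_pmf t"]
      by (simp add: Compl_eq_Diff_UNIV[symmetric])
    have "measure ?M L = measure ?M ((L \<inter> {..k}) \<union> (L \<inter> {k<..}))"
      by (rule arg_cong[of _ _ "measure ?M"]) auto
    also have "\<dots> = ?x + ?y"
      by (rule measure_pmf.finite_measure_Union) auto
    finally have L: "measure ?M L = ?x + ?y" .
    \<comment> \<open>Splitting L at k shows \<open>F k\<close> as a difference of two numbers that
      both lie between 0 and \<open>?a * ?b\<close>. Hence its absolute value is at most the product
      of the two tails.\<close>
    have F: "F k = ?x * ?a - ?y * ?b" unfolding F_def L ab by (simp add: algebra_simps)
    have xb: "0 \<le> ?x" "?x \<le> ?b" by (auto intro: measure_pmf.finite_measure_mono)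
    have ya: "0 \<le> ?y" "?y \<le> ?a" by (auto intro: measure_pmf.finite_measure_mono)
    have "?x * ?a \<le> ?b * ?a" "?y * ?b \<le> ?a * ?b" "0 \<le> ?x * ?a" "0 \<le> ?y * ?b"
      using xb ya by (auto intro!: mult_right_mono)
    then have 1: "\<bar>F k\<bar> \<le> ?a * ?b" unfolding F using mult.commute[of ?a ?b] by linarith
    have "?a * ?b = ?b * ((real k + 1 - t) * ?a) + ?a * ((t - real k) * ?b)"
      by (simp add: algebra_simps)
    also have "\<dots> \<le> ?b * (t * ?p k) + ?a * (t * ?p k)"
      by (intro add_mono mult_left_mono poisson_lower_tail poisson_upper_tail t) auto
    also have "\<dots> = (?a + ?b) * (t * ?p k)" by (simp only: distrib_right add.commute)
    also have "\<dots> = t * ?p k" using ab by simp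
    finally show ?thesis using 1 by linarith
  qed
  have "\<bar>f k\<bar> \<le> 1" for k
  proof (cases k)
    case (Suc m)
    then show ?thesis using bound[of m] pos[of m] t
      by (simp add: f_def abs_mult divide_le_eq del: pmf_poisson)
  qed (simp add: f_def)
  moreover have "t * f (Suc k) - real k * f k = indicator L k - measure ?M L" for k
  proof (cases k)
    case 0
    have "{..0::nat} = {0}" by auto
    then have "F 0 = (indicator L 0 - measure ?M L) * ?p 0"
      by (cases "0 \<in> L") (auto simp: F_def measure_pmf_single algebra_simps simp del: pmf_poisson)
    then show ?thesis using 0 pos[of 0] t by (simp add: f_def field_simps)
  next
    case (Suc m)
    have 1: "measure ?M {..Suc m} = measure ?M {..m} + ?p (Suc m)"
      by (simp add: measure_measure_pmf_finite del: pmf_poisson)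
    have 2: "measure ?M (L \<inter> {..Suc m}) = measure ?M (L \<inter> {..m}) + indicator L (Suc m) * ?p (Suc m)"
    proof (cases "Suc m \<in> L")
      case True
      then have "L \<inter> {..Suc m} = insert (Suc m) (L \<inter> {..m})" by auto
      then show ?thesis using True by (simp add: measure_measure_pmf_finite del: pmf_poisson)
    next
      case False
      then have "L \<inter> {..Suc m} = L \<inter> {..m}" by (auto simp: le_Suc_eq)
      then show ?thesis using False by simp
    qed
    have F: "F (Suc m) = F m + (indicator L (Suc m) - measure ?M L) * ?p (Suc m)"
      unfolding F_def 1 2 by (simp add: algebra_simps)
    have "real (Suc m) * (F m / (t * ?p m)) = F m / ?p (Suc m)"
      unfolding poisson_pmf_Suc[OF t, symmetric] by (simp del: of_nat_Suc pmf_poisson)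
    then show ?thesis unfolding Suc using F pos[of "Suc m"] t
      by (simp add: f_def field_simps del: pmf_poisson)
  qed
  ultimately show ?thesis using that by blast
qed

text \<open>Inserting the number of hits W into the Stein equation leaves the expectation of t
  f(W+1) - W f(W) to be bounded. Replacing t by |I| a costs the first term of the bound. The rest is
  a sum over k in which W is compared with the count outside the neighbourhood \<open>B k\<close>,
  on which hypothesis \<open>far\<close> gives near independence from \<open>X k\<close>.\<close>

lemma (in prob_space) chen_stein_poisson:
  fixes X :: "'i \<Rightarrow> 'a set" and B :: "'i \<Rightarrow> 'i set" and L :: "nat set"
  defines "W \<equiv> \<lambda>J \<omega>. card {j \<in> J. \<omega> \<in> X j}"
  assumes I: "finite I" and X: "\<And>k. k \<in> I \<Longrightarrow> X k \<in> events" and t: "t > 0" and a: "a \<ge> 0"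
    and B: "\<And>k. k \<in> I \<Longrightarrow> B k \<subseteq> I" "\<And>k. k \<in> I \<Longrightarrow> k \<in> B k"
    and far: "\<And>k w. k \<in> I \<Longrightarrow>
      \<bar>prob (X k \<inter> {\<omega> \<in> space M. W (I - B k) \<omega> = w}) - a * prob {\<omega> \<in> space M. W (I - B k) \<omega> = w}\<bar>
        \<le> c * a * prob {\<omega> \<in> space M. W (I - B k) \<omega> = w}"
  shows "\<bar>prob {\<omega> \<in> space M. W I \<omega> \<in> L} - measure (poisson_pmf t) L\<bar>
    \<le> \<bar>t - real (card I) * a\<bar> + real (card I) * (c * a)
      + 2 * (\<Sum>k\<in>I. a * (\<Sum>j\<in>B k. prob (X j)) + (\<Sum>j\<in>B k - {k}. prob (X k \<inter> X j)))"
proof -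
  obtain f :: "nat \<Rightarrow> real" where f1: "\<And>k. \<bar>f k\<bar> \<le> 1"
    and f: "\<And>k. t * f (Suc k) - real k * f k = indicator L k - measure (poisson_pmf t) L"
    using poisson_stein_solution[OF t, of L] by blast
  have W_sum: "real (W J \<omega>) = (\<Sum>j\<in>J. indicator (X j) \<omega>)" if "J \<subseteq> I" for J \<omega>
  proof -
    have "finite J" using that I finite_subset by blast
    then show ?thesis
      by (simp add: W_def indicator_def of_bool_def sum.If_cases Int_def)
  qed
  have W_meas: "W J \<in> measurable M (count_space UNIV)" if "J \<subseteq> I" for J
  proof -
    have "finite J" using that I finite_subset by blast
    have "W J = (\<lambda>\<omega>. \<Sum>j\<in>J. indicator (X j) \<omega>)"
      using \<open>finite J\<close> by (intro ext) (simp add: W_def indicator_def of_bool_def sum.If_cases Int_def)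
    moreover have "(\<lambda>\<omega>. \<Sum>j\<in>J. indicator (X j) \<omega> :: nat) \<in> measurable M (count_space UNIV)"
      unfolding measurable_cong_sets[OF refl sets_borel_eq_count_space, symmetric]
      using that X by (intro borel_measurable_sum borel_measurable_indicator) auto
    ultimately show ?thesis by simp
  qed
  have W_ev: "{\<omega> \<in> space M. W J \<omega> \<in> K} \<in> events" if "J \<subseteq> I" for J K
    using measurable_sets[OF W_meas[OF that], of K] by (simp add: vimage_def Int_def conj_commute)
  have fW_int: "integrable M (\<lambda>\<omega>. g (W J \<omega>))" if "J \<subseteq> I" "\<And>k. \<bar>g k\<bar> \<le> 1" for J and g :: "nat \<Rightarrow> real"
    using that by (intro integrable_const_bound[of _ 1] measurable_compose[OF W_meas]) auto
  have XfW_int: "integrable M (\<lambda>\<omega>. indicator (X k) \<omega> * g (W J \<omega>))"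
    if "J \<subseteq> I" "\<And>k. \<bar>g k\<bar> \<le> 1" "k \<in> I" for J k and g :: "nat \<Rightarrow> real"
  proof (rule integrable_const_bound[of _ 1])
    show "AE \<omega> in M. norm (indicator (X k) \<omega> * g (W J \<omega>)) \<le> 1"
      using that by (auto simp: abs_mult indicator_def)
    show "(\<lambda>\<omega>. indicator (X k) \<omega> * g (W J \<omega>)) \<in> borel_measurable M"
      using that X by (intro borel_measurable_times borel_measurable_indicator measurable_compose[OF W_meas]) auto
  qed
  \<comment> \<open>The difference a f(W+1) - 1_{X k} f(W) is split into three: pass to the count
    outside \<open>B k\<close> in the first term, exchange a for the indicator, and pass back in the
    second term.\<close>
  define D1 where "D1 k \<omega> = a * (f (Suc (W I \<omega>)) - f (Suc (W (I - B k) \<omega>)))" for k \<omega>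
  define D2 where "D2 k \<omega> = a * f (Suc (W (I - B k) \<omega>)) - indicator (X k) \<omega> * f (Suc (W (I - B k) \<omega>))" for k \<omega>
  define D3 where "D3 k \<omega> = indicator (X k) \<omega> * (f (Suc (W (I - B k) \<omega>)) - f (W I \<omega>))" for k \<omega>
  have D_int: "integrable M (D1 k)" "integrable M (D2 k)" "integrable M (D3 k)" if "k \<in> I" for k
  proof -
    have i: "integrable M (\<lambda>\<omega>. f (Suc (W I \<omega>)))" "integrable M (\<lambda>\<omega>. f (Suc (W (I - B k) \<omega>)))"
      using fW_int[of I "\<lambda>w. f (Suc w)"] fW_int[of "I - B k" "\<lambda>w. f (Suc w)"] f1 by auto
    have x: "integrable M (\<lambda>\<omega>. indicator (X k) \<omega> * f (Suc (W (I - B k) \<omega>)))"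
        "integrable M (\<lambda>\<omega>. indicator (X k) \<omega> * f (W I \<omega>))"
      using XfW_int[of "I - B k" "\<lambda>w. f (Suc w)" k] XfW_int[of I f k] f1 that by auto
    show "integrable M (D1 k)" "integrable M (D2 k)" "integrable M (D3 k)"
      unfolding D1_def[abs_def] D2_def[abs_def] D3_def[abs_def] right_diff_distrib using i x by auto
  qed
  have split: "indicator L (W I \<omega>) - measure (poisson_pmf t) L
      = (t - real (card I) * a) * f (Suc (W I \<omega>)) + (\<Sum>k\<in>I. D1 k \<omega> + D2 k \<omega> + D3 k \<omega>)" for \<omega>
  proof -
    have "(\<Sum>k\<in>I. D1 k \<omega> + D2 k \<omega> + D3 k \<omega>)
        = (\<Sum>k\<in>I. a * f (Suc (W I \<omega>)) - indicator (X k) \<omega> * f (W I \<omega>))"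
      by (intro sum.cong) (auto simp: D1_def D2_def D3_def algebra_simps)
    also have "\<dots> = real (card I) * a * f (Suc (W I \<omega>)) - real (W I \<omega>) * f (W I \<omega>)"
      by (simp add: sum_subtractf W_sum sum_distrib_right)
    finally show ?thesis using f[of "W I \<omega>"] by (simp add: algebra_simps)
  qed
  have "prob {\<omega> \<in> space M. W I \<omega> \<in> L} - measure (poisson_pmf t) L
      = (LINT \<omega>|M. indicator L (W I \<omega>) - measure (poisson_pmf t) L)"
  proof -
    have "(LINT \<omega>|M. indicator L (W I \<omega>)) = (LINT \<omega>|M. indicator {\<omega> \<in> space M. W I \<omega> \<in> L} \<omega> :: real)"
      by (intro Bochner_Integration.integral_cong) (auto simp: indicator_def)
    also have "\<dots> = prob {\<omega> \<in> space M. W I \<omega> \<in> L}" using W_ev[of I L] by simp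
    finally have "(LINT \<omega>|M. indicator L (W I \<omega>)) = prob {\<omega> \<in> space M. W I \<omega> \<in> L}" .
    moreover have "integrable M (\<lambda>\<omega>. indicator L (W I \<omega>) :: real)"
      using fW_int[of I "indicator L"] by (simp add: indicator_def)
    ultimately show ?thesis by (simp add: prob_space)
  qed
  also have "\<dots> = (t - real (card I) * a) * (LINT \<omega>|M. f (Suc (W I \<omega>)))
      + (\<Sum>k\<in>I. (LINT \<omega>|M. D1 k \<omega>) + (LINT \<omega>|M. D2 k \<omega>) + (LINT \<omega>|M. D3 k \<omega>))"
    unfolding split using D_int fW_int[of I "\<lambda>w. f (Suc w)"] f1
    by (simp add: Bochner_Integration.integral_sum Bochner_Integration.integral_add)
  finally have eq: "prob {\<omega> \<in> space M. W I \<omega> \<in> L} - measure (poisson_pmf t) L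
    = (t - real (card I) * a) * (LINT \<omega>|M. f (Suc (W I \<omega>)))
      + (\<Sum>k\<in>I. (LINT \<omega>|M. D1 k \<omega>) + (LINT \<omega>|M. D2 k \<omega>) + (LINT \<omega>|M. D3 k \<omega>))" .
  have X_int: "integrable M (indicator (X k) :: _ \<Rightarrow> real)" if "k \<in> I" for k
    using X[OF that] by (intro integrable_real_indicator) (auto simp: emeasure_eq_measure)
  have XX_int: "integrable M (indicator (X k \<inter> X j) :: _ \<Rightarrow> real)" if "k \<in> I" "j \<in> I" for k j
    using X that by (intro integrable_real_indicator) (auto simp: emeasure_eq_measure)
  have f_diff: "\<bar>f u - f v\<bar> \<le> 2" for u v using f1[of u] f1[of v] by linarith
  \<comment> \<open>The two counts agree unless some event of the neighbourhood occurs, and two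
    values of f differ by at most 2.\<close>
  have b1: "\<bar>LINT \<omega>|M. D1 k \<omega>\<bar> \<le> 2 * (a * (\<Sum>j\<in>B k. prob (X j)))" if k: "k \<in> I" for k
  proof -
    have fin: "finite (B k)" using B(1)[OF k] I finite_subset by blast
    have bd: "\<bar>D1 k \<omega>\<bar> \<le> 2 * a * (\<Sum>j\<in>B k. indicator (X j) \<omega>)" for \<omega>
    proof (cases "\<exists>j\<in>B k. \<omega> \<in> X j")
      case True
      then obtain j where j: "j \<in> B k" "\<omega> \<in> X j" by blast
      have "(1::real) \<le> (\<Sum>j\<in>B k. indicator (X j) \<omega>)"
        using member_le_sum[of j "B k" "\<lambda>j. indicator (X j) \<omega> :: real"] fin j by simp
      then have "2 * a * 1 \<le> 2 * a * (\<Sum>j\<in>B k. indicator (X j) \<omega>)"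
        using a by (intro mult_left_mono) auto
      moreover have "\<bar>D1 k \<omega>\<bar> \<le> a * 2" unfolding D1_def using a f_diff
        by (auto simp: abs_mult intro!: mult_left_mono)
      ultimately show ?thesis by linarith
    next
      case False
      then have "{j \<in> I. \<omega> \<in> X j} = {j \<in> I - B k. \<omega> \<in> X j}" by auto
      then show ?thesis using a by (simp add: D1_def W_def sum_nonneg)
    qed
    have "\<bar>LINT \<omega>|M. D1 k \<omega>\<bar> \<le> (LINT \<omega>|M. \<bar>D1 k \<omega>\<bar>)" by (rule integral_abs_bound)
    also have "\<dots> \<le> (LINT \<omega>|M. 2 * a * (\<Sum>j\<in>B k. indicator (X j) \<omega>))"
      using D_int(1)[OF k] B(1)[OF k] bd
      by (intro integral_mono X_int integrable_abs integrable_mult_right Bochner_Integration.integrable_sum) auto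
    also have "\<dots> = 2 * a * (\<Sum>j\<in>B k. prob (X j))"
    proof -
      have "(LINT \<omega>|M. (\<Sum>j\<in>B k. indicator (X j) \<omega>)) = (\<Sum>j\<in>B k. prob (X j))"
        using X X_int B(1)[OF k] by (subst Bochner_Integration.integral_sum) (auto intro!: sum.cong)
      then show ?thesis by simp
    qed
    finally show ?thesis by simp
  qed
  \<comment> \<open>If \<open>X k\<close> occurs and no other event of \<open>B k\<close> does, then
    the full count is exactly one more than the count outside \<open>B k\<close>, so the difference
    vanishes. This is why the sum omits k itself.\<close>
  have b3: "\<bar>LINT \<omega>|M. D3 k \<omega>\<bar> \<le> 2 * (\<Sum>j\<in>B k - {k}. prob (X k \<inter> X j))" if k: "k \<in> I" for k
  proof -
    have fin: "finite (B k)" using B(1)[OF k] I finite_subset by blast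
    have bd: "\<bar>D3 k \<omega>\<bar> \<le> 2 * (\<Sum>j\<in>B k - {k}. indicator (X k \<inter> X j) \<omega>)" for \<omega>
    proof (cases "\<omega> \<in> X k \<and> (\<exists>j\<in>B k - {k}. \<omega> \<in> X j)")
      case True
      then obtain j where j: "j \<in> B k - {k}" "\<omega> \<in> X j" "\<omega> \<in> X k" by blast
      have "(1::real) \<le> (\<Sum>j\<in>B k - {k}. indicator (X k \<inter> X j) \<omega>)"
        using member_le_sum[of j "B k - {k}" "\<lambda>j. indicator (X k \<inter> X j) \<omega> :: real"] fin j by simp
      moreover have "\<bar>D3 k \<omega>\<bar> \<le> 2" unfolding D3_def using j f_diff by (auto simp: abs_mult)
      ultimately show ?thesis by linarith
    next
      case False
      have "D3 k \<omega> = 0"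
      proof (cases "\<omega> \<in> X k")
        case True
        then have "{j \<in> I. \<omega> \<in> X j} = insert k {j \<in> I - B k. \<omega> \<in> X j}"
          using False k B by auto
        then have "W I \<omega> = Suc (W (I - B k) \<omega>)" using I B(2)[OF k] by (simp add: W_def)
        then show ?thesis by (simp add: D3_def)
      qed (simp add: D3_def)
      then show ?thesis by (simp add: sum_nonneg)
    qed
    have "\<bar>LINT \<omega>|M. D3 k \<omega>\<bar> \<le> (LINT \<omega>|M. \<bar>D3 k \<omega>\<bar>)" by (rule integral_abs_bound)
    also have "\<dots> \<le> (LINT \<omega>|M. 2 * (\<Sum>j\<in>B k - {k}. indicator (X k \<inter> X j) \<omega>))"
      using D_int(3)[OF k] k B(1)[OF k] bd
      by (intro integral_mono XX_int integrable_abs integrable_mult_right Bochner_Integration.integrable_sum) auto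
    also have "\<dots> = 2 * (\<Sum>j\<in>B k - {k}. prob (X k \<inter> X j))"
    proof -
      have ev: "X k \<inter> X j \<in> events" if "j \<in> B k - {k}" for j using X k B(1)[OF k] that by auto
      have "(LINT \<omega>|M. (\<Sum>j\<in>B k - {k}. indicator (X k \<inter> X j) \<omega>)) = (\<Sum>j\<in>B k - {k}. prob (X k \<inter> X j))"
        using ev XX_int[OF k] B(1)[OF k] by (subst Bochner_Integration.integral_sum) (auto intro!: sum.cong)
      then show ?thesis by simp
    qed
    finally show ?thesis .
  qed
  \<comment> \<open>The expectation is decomposed by the value w of the count outside
    \<open>B k\<close>; \<open>far\<close> bounds each term by \<open>c * a\<close> times the
    probability of that value, and these probabilities add up to 1.\<close>
  have b2: "\<bar>LINT \<omega>|M. D2 k \<omega>\<bar> \<le> c * a" if k: "k \<in> I" for k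
  proof -
    let ?R = "\<lambda>w. {\<omega> \<in> space M. W (I - B k) \<omega> = w}"
    let ?m = "card I"
    have R_ev: "?R w \<in> events" for w using W_ev[of "I - B k" "{w}"] by simp
    have Wm: "W (I - B k) \<omega> \<le> ?m" for \<omega>
      unfolding W_def using I by (intro card_mono) auto
    have expand: "D2 k \<omega> = (\<Sum>w\<le>?m. f (Suc w) * (a * indicator (?R w) \<omega> - indicator (X k \<inter> ?R w) \<omega>))"
      if "\<omega> \<in> space M" for \<omega>
    proof -
      have "(\<Sum>w\<le>?m. f (Suc w) * (a * indicator (?R w) \<omega> - indicator (X k \<inter> ?R w) \<omega>))
        = (\<Sum>w\<le>?m. if w = W (I - B k) \<omega> then f (Suc w) * (a - indicator (X k) \<omega>) else 0)"
        using that by (intro sum.cong) (auto simp: indicator_def)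
      then show ?thesis using Wm[of \<omega>] by (simp add: D2_def algebra_simps)
    qed
    have "(LINT \<omega>|M. D2 k \<omega>)
        = (LINT \<omega>|M. (\<Sum>w\<le>?m. f (Suc w) * (a * indicator (?R w) \<omega> - indicator (X k \<inter> ?R w) \<omega>)))"
      using expand by (intro Bochner_Integration.integral_cong) auto
    also have "\<dots> = (\<Sum>w\<le>?m. f (Suc w) * (a * prob (?R w) - prob (X k \<inter> ?R w)))"
    proof -
      have i: "integrable M (indicator (?R w) :: _ \<Rightarrow> real)"
          "integrable M (indicator (X k \<inter> ?R w) :: _ \<Rightarrow> real)" for w
        using R_ev[of w] X[OF k] by (auto intro!: integrable_real_indicator simp: emeasure_eq_measure)
      show ?thesis using i R_ev X[OF k]
        by (subst Bochner_Integration.integral_sum) (auto simp: Bochner_Integration.integral_diff)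
    qed
    finally have "\<bar>LINT \<omega>|M. D2 k \<omega>\<bar> \<le> (\<Sum>w\<le>?m. \<bar>f (Suc w) * (a * prob (?R w) - prob (X k \<inter> ?R w))\<bar>)"
      by (simp only:) (rule sum_abs)
    also have "\<dots> \<le> (\<Sum>w\<le>?m. c * a * prob (?R w))"
    proof (intro sum_mono)
      fix w
      have "\<bar>f (Suc w) * (a * prob (?R w) - prob (X k \<inter> ?R w))\<bar> \<le> 1 * \<bar>a * prob (?R w) - prob (X k \<inter> ?R w)\<bar>"
        unfolding abs_mult by (intro mult_right_mono f1) auto
      then show "\<bar>f (Suc w) * (a * prob (?R w) - prob (X k \<inter> ?R w))\<bar> \<le> c * a * prob (?R w)"
        using order_trans[OF _ far[OF k, of w]] by (simp only: abs_minus_commute mult_1)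
    qed
    also have "\<dots> = c * a * prob (\<Union>w\<in>{..?m}. ?R w)"
      using R_ev by (subst finite_measure_finite_Union) (auto simp: disjoint_family_on_def sum_distrib_left)
    also have "(\<Union>w\<in>{..?m}. ?R w) = space M" using Wm by auto
    finally show ?thesis by (simp add: prob_space)
  qed
  have b0: "\<bar>LINT \<omega>|M. f (Suc (W I \<omega>))\<bar> \<le> 1"
  proof -
    have "\<bar>LINT \<omega>|M. f (Suc (W I \<omega>))\<bar> \<le> (LINT \<omega>|M. \<bar>f (Suc (W I \<omega>))\<bar>)" by (rule integral_abs_bound)
    also have "\<dots> \<le> (LINT \<omega>|M. 1)"
      using fW_int[of I "\<lambda>w. f (Suc w)"] f1 by (intro integral_mono) auto
    finally show ?thesis by (simp add: prob_space)
  qed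
  have "\<bar>prob {\<omega> \<in> space M. W I \<omega> \<in> L} - measure (poisson_pmf t) L\<bar>
      \<le> \<bar>t - real (card I) * a\<bar> * \<bar>LINT \<omega>|M. f (Suc (W I \<omega>))\<bar>
        + (\<Sum>k\<in>I. \<bar>(LINT \<omega>|M. D1 k \<omega>) + (LINT \<omega>|M. D2 k \<omega>) + (LINT \<omega>|M. D3 k \<omega>)\<bar>)"
    unfolding eq by (rule order_trans[OF abs_triangle_ineq]) (intro add_mono sum_abs, simp add: abs_mult)
  also have "\<dots> \<le> \<bar>t - real (card I) * a\<bar> * 1
        + (\<Sum>k\<in>I. c * a + 2 * (a * (\<Sum>j\<in>B k. prob (X j)) + (\<Sum>j\<in>B k - {k}. prob (X k \<inter> X j))))"
  proof (intro add_mono mult_left_mono b0 sum_mono)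
    fix k assume k: "k \<in> I"
    show "\<bar>(LINT \<omega>|M. D1 k \<omega>) + (LINT \<omega>|M. D2 k \<omega>) + (LINT \<omega>|M. D3 k \<omega>)\<bar>
        \<le> c * a + 2 * (a * (\<Sum>j\<in>B k. prob (X j)) + (\<Sum>j\<in>B k - {k}. prob (X k \<inter> X j)))"
      using b1[OF k] b2[OF k] b3[OF k] by (simp add: algebra_simps)
  qed auto
  also have "\<dots> = \<bar>t - real (card I) * a\<bar> + real (card I) * (c * a)
      + 2 * (\<Sum>k\<in>I. a * (\<Sum>j\<in>B k. prob (X j)) + (\<Sum>j\<in>B k - {k}. prob (X k \<inter> X j)))"
    by (simp add: sum.distrib sum_distrib_left algebra_simps)
  finally show ?thesis .
qed

subsection \<open>Mixing for interlaced blocks\<close>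

definition determined_by :: "nat set \<Rightarrow> (nat \<Rightarrow> 'a) set \<Rightarrow> bool" where
  "determined_by J R \<longleftrightarrow> (\<forall>\<omega> \<omega>'. (\<forall>j\<in>J. \<omega> j = \<omega>' j) \<longrightarrow> \<omega> \<in> R \<longrightarrow> \<omega>' \<in> R)"

text \<open>Only the values of \<open>y\<close> on \<open>J\<close> matter, so different
  \<open>y\<close> may describe the same atom.\<close>

definition atom :: "nat set \<Rightarrow> (nat \<Rightarrow> 'a) \<Rightarrow> (nat \<Rightarrow> 'a) set" where
  "atom J y = {\<omega>. \<forall>j\<in>J. \<omega> j = y j}"

text \<open>The preimage of \<open>cylinder as\<close> under the s-th iterate of the shift.\<close>

definition block :: "nat \<Rightarrow> 'a list \<Rightarrow> (nat \<Rightarrow> 'a) set" where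
  "block s as = {\<omega>. \<forall>i < length as. \<omega> (s + i) = as ! i}"

lemma block_0: "block 0 as = cylinder as"
  by (simp add: block_def cylinder_def)

lemma determined_by_Int:
  "determined_by J R \<Longrightarrow> determined_by K S \<Longrightarrow> determined_by (J \<union> K) (R \<inter> S)"
  unfolding determined_by_def by blast

lemma determined_by_INT:
  assumes "\<And>i. i \<in> I \<Longrightarrow> determined_by (J i) (R i)"
  shows "determined_by (\<Union>i\<in>I. J i) (\<Inter>i\<in>I. R i)"
  unfolding determined_by_def
proof (intro allI impI INT_I)
  fix \<omega> \<omega>' i
  assume "\<forall>j\<in>\<Union> (J ` I). \<omega> j = \<omega>' j" "\<omega> \<in> \<Inter> (R ` I)" "i \<in> I"
  then have "\<forall>j\<in>J i. \<omega> j = \<omega>' j" "\<omega> \<in> R i" by auto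
  then show "\<omega>' \<in> R i" using assms[OF \<open>i \<in> I\<close>] unfolding determined_by_def by metis
qed

lemma determined_by_atom: "determined_by J (atom J y)"
  unfolding determined_by_def atom_def by auto

lemma determined_by_block: "determined_by {s..<s + length as} (block s as)"
  unfolding determined_by_def block_def by auto

lemma determined_by_empty: "determined_by {} R \<Longrightarrow> R = {} \<or> R = UNIV"
  unfolding determined_by_def by auto

lemma shift_iterate: "(left_shift ^^ s) \<omega> = (\<lambda>i. \<omega> (s + i))"
  by (induction s) (auto simp: left_shift_def)

text \<open>A countable alphabet allows only countably many patterns on a finite set of
  coordinates.\<close>

lemma determined_by_countable_partition:
  fixes R :: "(nat \<Rightarrow> 'a::countable) set"
  assumes "finite J" and R: "determined_by J R"
  obtains Y :: "(nat \<Rightarrow> 'a) set"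
  where "countable Y" "disjoint_family_on (atom J) Y" "R = (\<Union>y\<in>Y. atom J y)"
proof -
  \<comment> \<open>\<open>restrict\<close> fixes the values outside \<open>J\<close>, so distinct
    representatives differ somewhere on \<open>J\<close> and their atoms are disjoint.\<close>
  define Y where "Y = (\<lambda>\<omega>. restrict \<omega> J) ` R"
  have "Y \<subseteq> (\<Pi>\<^sub>E j\<in>J. UNIV)" unfolding Y_def by auto
  moreover have "countable (\<Pi>\<^sub>E j\<in>J. UNIV :: 'a set)" using assms(1) by (intro countable_PiE) auto
  ultimately have "countable Y" using countable_subset by blast
  moreover have "disjoint_family_on (atom J) Y"
    unfolding disjoint_family_on_def Y_def atom_def
    by (auto simp: fun_eq_iff restrict_def)
  moreover have "R = (\<Union>y\<in>Y. atom J y)"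
  proof
    show "R \<subseteq> (\<Union>y\<in>Y. atom J y)" unfolding Y_def atom_def by auto
    show "(\<Union>y\<in>Y. atom J y) \<subseteq> R"
      using R unfolding Y_def atom_def determined_by_def by auto metis
  qed
  ultimately show ?thesis using that by blast
qed

lemma determined_by_coord_algebra:
  fixes R :: "(nat \<Rightarrow> 'a::countable) set"
  assumes "finite J" and R: "determined_by J R" and J: "\<And>j. j \<in> J \<Longrightarrow> a \<le> j \<and> enat j \<le> b"
  shows "R \<in> coord_algebra a b"
proof -
  interpret sigma_algebra UNIV "coord_algebra a b :: (nat \<Rightarrow> 'a) set set"
    unfolding coord_algebra_def by (rule sigma_algebra_sigma_sets) auto
  have at: "atom J y \<in> coord_algebra a b" for y :: "nat \<Rightarrow> 'a"
  proof (cases "J = {}")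
    case True
    then show ?thesis using top by (simp add: atom_def)
  next
    case False
    have "atom J y = (\<Inter>j\<in>J. (\<lambda>\<omega>. \<omega> j) -` {y j})" by (auto simp: atom_def)
    moreover have "(\<lambda>\<omega>. \<omega> j) -` {y j} \<in> coord_algebra a b" if "j \<in> J" for j
      unfolding coord_algebra_def using J[OF that] by (intro sigma_sets.Basic) auto
    ultimately show ?thesis using False assms(1) by auto
  qed
  obtain Y where Y: "countable Y" "R = (\<Union>y\<in>Y. atom J y)"
    using determined_by_countable_partition[OF assms(1) R] by metis
  show ?thesis unfolding Y(2) using Y(1) at by (intro countable_UN'') auto
qed

text \<open>An event about coordinate i is a countable union of cylinders of length i + 1. This
  supplies measurability of every event determined by finitely many coordinates.\<close>

lemma coord_algebra_subset:
  "coord_algebra a b \<subseteq> (cylinder_algebra :: (nat \<Rightarrow> 'a::countable) set set)"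
proof -
  interpret sigma_algebra UNIV "cylinder_algebra :: (nat \<Rightarrow> 'a) set set"
    unfolding cylinder_algebra_def by (rule sigma_algebra_sigma_sets) auto
  have "(\<lambda>\<omega>. \<omega> i) -` B \<in> cylinder_algebra" for i and B :: "'a set"
  proof -
    have "(\<lambda>\<omega>. \<omega> i) -` B = (\<Union>as\<in>{as. length as = Suc i \<and> as ! i \<in> B}. cylinder as)"
    proof (intro set_eqI iffI)
      fix \<omega> :: "nat \<Rightarrow> 'a" assume "\<omega> \<in> (\<lambda>\<omega>. \<omega> i) -` B"
      then show "\<omega> \<in> (\<Union>as\<in>{as. length as = Suc i \<and> as ! i \<in> B}. cylinder as)"
        by (intro UN_I[of "map \<omega> [0..<Suc i]"]) (auto simp: cylinder_def simp del: upt_Suc)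
    qed (auto simp: cylinder_def)
    moreover have "cylinder as \<in> cylinder_algebra" for as :: "'a list"
      unfolding cylinder_algebra_def cylinders_def by (intro sigma_sets.Basic) auto
    ultimately show ?thesis by (auto intro!: countable_UN'')
  qed
  then show ?thesis unfolding coord_algebra_def by (intro sigma_sets_subset) auto
qed

text \<open>Inequalities on the pieces are added up. The sums are written as nonnegative integrals
  over the counting measure, which avoids questions of summability.\<close>

lemma (in finite_measure) measure_countable_partition_le:
  assumes I: "countable I" "disjoint_family_on X I" "\<And>i. i \<in> I \<Longrightarrow> X i \<in> sets M"
    and A: "A \<in> sets M" and B: "B \<in> sets M" and nn: "u \<ge> 0" "v \<ge> 0"
    and le: "\<And>i. i \<in> I \<Longrightarrow> u * measure M (A \<inter> X i) \<le> v * measure M (B \<inter> X i)"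
  shows "u * measure M (A \<inter> (\<Union>i\<in>I. X i)) \<le> v * measure M (B \<inter> (\<Union>i\<in>I. X i))"
proof -
  have eq: "ennreal (w * measure M (C \<inter> (\<Union>i\<in>I. X i)))
      = (\<integral>\<^sup>+ i. ennreal (w * measure M (C \<inter> X i)) \<partial>count_space I)"
    if "C \<in> sets M" "w \<ge> 0" for C and w :: real
  proof -
    have "emeasure M (\<Union>i\<in>I. C \<inter> X i) = (\<integral>\<^sup>+ i. emeasure M (C \<inter> X i) \<partial>count_space I)"
      using that I by (intro emeasure_UN_countable) (auto simp: disjoint_family_on_def)
    then show ?thesis using that(2)
      by (simp add: emeasure_eq_measure ennreal_mult nn_integral_cmult)
  qed
  have "ennreal (u * measure M (A \<inter> (\<Union>i\<in>I. X i))) \<le> ennreal (v * measure M (B \<inter> (\<Union>i\<in>I. X i)))"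
    unfolding eq[OF A nn(1)] eq[OF B nn(2)]
    by (intro nn_integral_mono ennreal_leI) (auto simp: le)
  then show ?thesis using nn(2) by (simp add: ennreal_le_iff)
qed

section \<open>Mixing inequalities under a shift-invariant probability\<close>

locale shift_invariant = prob_space P for P :: "(nat \<Rightarrow> 'a::countable) measure" +
  assumes space_P: "space P = UNIV" and sets_P: "sets P = cylinder_algebra"
    and invariant: "distr P P left_shift = P"
begin

lemma determined_by_events: "finite J \<Longrightarrow> determined_by J R \<Longrightarrow> R \<in> events"
  unfolding sets_P
  by (rule subsetD[OF coord_algebra_subset[of 0 \<infinity>]]) (rule determined_by_coord_algebra, auto)

lemma block_events: "block s as \<in> events"
  by (rule determined_by_events[OF _ determined_by_block]) simp

lemma prob_block: "prob (block s as) = prob (cylinder as)"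
proof (induction s)
  case (Suc s)
  have vim: "left_shift -` block s as = block (Suc s) as" for s and as :: "'a list"
    by (auto simp: block_def left_shift_def)
  \<comment> \<open>Evaluating \<open>distr\<close> as an image measure requires a measurable shift.
    Measurability is checked on the generating cylinders, whose preimages are blocks at position
    1.\<close>
  have "left_shift \<in> measurable P P"
    unfolding measurable_def
  proof (intro CollectI conjI ballI)
    fix S :: "(nat \<Rightarrow> 'a) set" assume "S \<in> events"
    then have "S \<in> sigma_sets UNIV (\<Union>n. cylinders n)" unfolding sets_P cylinder_algebra_def .
    then show "left_shift -` S \<inter> space P \<in> events"
    proof induction
      case (Basic a)
      then obtain as where "a = cylinder as" by (auto simp: cylinders_def)
      then show ?case using vim[of 0 as] block_events[of 1 as] by (simp add: block_0 space_P)
    next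
      case Empty
      show ?case by simp
    next
      case (Compl a)
      have "left_shift -` (UNIV - a) \<inter> space P = space P - left_shift -` a \<inter> space P"
        by (auto simp: space_P)
      then show ?case using Compl.IH by auto
    next
      case (Union a)
      then show ?case by (auto simp: vimage_UN space_P)
    qed
  qed (simp add: space_P)
  then have "measure (distr P P left_shift) (block s as) = prob (block (Suc s) as)"
    using block_events by (simp add: measure_distr vim space_P)
  then show ?case using Suc.IH by (simp add: invariant)
qed (simp add: block_0)

text \<open>The product form of the mixing bound, which also covers null events. Finiteness of
  \<open>psi P m\<close> matters because \<open>enn2real\<close> sends \<infinity> to 0.\<close>

lemma psi_determined:
  fixes B C :: "(nat \<Rightarrow> 'a) set"
  assumes fin: "psi P m < \<infinity>" and J: "finite J" "determined_by J B" and K: "finite K" "determined_by K C"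
    and gap: "\<And>j k. j \<in> J \<Longrightarrow> k \<in> K \<Longrightarrow> j + m + 1 \<le> k"
  shows "\<bar>prob (B \<inter> C) - prob B * prob C\<bar> \<le> enn2real (psi P m) * (prob B * prob C)"
proof -
  have ev: "B \<in> events" "C \<in> events" using determined_by_events J K by auto
  consider "J = {}" | "prob B * prob C = 0" | "J \<noteq> {}" "prob B * prob C \<noteq> 0" by blast
  then show ?thesis
  proof cases
    \<comment> \<open>Without coordinates there is no last index of the past; but then
      \<open>B\<close> is trivial and the left side is 0.\<close>
    case 1
    then have "B = {} \<or> B = UNIV" using J determined_by_empty by blast
    then show ?thesis using prob_space by (auto simp: space_P)
  next
    case 2
    have "prob (B \<inter> C) \<le> prob B" "prob (B \<inter> C) \<le> prob C" using ev by (auto intro: finite_measure_mono)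
    moreover have "prob B = 0 \<or> prob C = 0" using 2 by simp
    ultimately have "prob (B \<inter> C) = 0" by (metis measure_nonneg order_antisym)
    then show ?thesis using 2 by auto
  next
    case 3
    \<comment> \<open>The past ends at \<open>Max J\<close>; by \<open>gap\<close>, all of
      \<open>K\<close> lies at or beyond \<open>Max J + m + 1\<close>, as in the definition of
      \<open>psi\<close>.\<close>
    let ?n = "Max J" and ?x = "\<bar>prob (B \<inter> C) / (prob B * prob C) - 1\<bar>"
    have pos: "prob B * prob C > 0" using 3 by (simp add: less_le)
    have "B \<in> coord_algebra 0 (enat ?n)" using J by (intro determined_by_coord_algebra[of J]) auto
    moreover have "C \<in> coord_algebra (?n + m + 1) \<infinity>"
      using K gap Max_in[OF J(1) 3(1)] by (intro determined_by_coord_algebra[of K]) auto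
    ultimately have "ennreal ?x \<le> psi_dep P (coord_algebra 0 (enat ?n)) (coord_algebra (?n + m + 1) \<infinity>)"
      unfolding psi_dep_def using 3 by (intro SUP_upper2[of "(B, C)"]) auto
    also have "\<dots> \<le> psi P m" unfolding psi_def by (rule SUP_upper) simp
    finally have "?x \<le> enn2real (psi P m)"
      using fin by (metis abs_ge_zero enn2real_ennreal enn2real_mono infinity_ennreal_def)
    then have "?x * (prob B * prob C) \<le> enn2real (psi P m) * (prob B * prob C)"
      using pos by (intro mult_right_mono) auto
    moreover have "?x * (prob B * prob C) = \<bar>(prob (B \<inter> C) / (prob B * prob C) - 1) * (prob B * prob C)\<bar>"
      using pos by (simp add: abs_mult)
    moreover have "(prob (B \<inter> C) / (prob B * prob C) - 1) * (prob B * prob C) = prob (B \<inter> C) - prob B * prob C"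
    proof -
      have "(x / y - 1) * y = x - y" if "y \<noteq> 0" for x y :: real
        using that by (simp add: field_simps)
      then show ?thesis using 3(2) by blast
    qed
    ultimately show ?thesis by simp
  qed
qed

text \<open>
  The alphabet being countable, \<open>R\<close> is a countable union of atoms. Each atom is the intersection of an
  event before and an event after the block, to which the mixing bound applies.
\<close>

lemma block_interlaced:
  fixes as :: "'a list" and R :: "(nat \<Rightarrow> 'a) set"
  defines "e \<equiv> enn2real (psi P (length as))"
  assumes fin: "psi P (length as) < \<infinity>" and e1: "e < 1" and J: "finite J" "determined_by J R"
    and gap: "\<And>j. j \<in> J \<Longrightarrow> j + length as < s \<or> s + 2 * length as \<le> j"
  shows "(1 - e) * prob (block s as \<inter> R) \<le> (1 + e)\<^sup>2 * prob (cylinder as) * prob R"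
    and "(1 - e)\<^sup>2 * prob (cylinder as) * prob R \<le> (1 + e) * prob (block s as \<inter> R)"
proof -
  let ?n = "length as" and ?p = "prob (cylinder as)" and ?A = "block s as"
  have e0: "e \<ge> 0" by (simp add: e_def)
  obtain Y where Y: "countable Y" "disjoint_family_on (atom J) Y" "R = (\<Union>y\<in>Y. atom J y)"
    using determined_by_countable_partition[OF J] by metis
  have atom_ev: "atom J y \<in> events" for y
    using J determined_by_atom by (intro determined_by_events[of J]) auto
  \<comment> \<open>The intersections with \<open>UNIV\<close> give the inequalities the shape that
    \<open>measure_countable_partition_le\<close> sums over the atoms.\<close>
  have both: "(1 - e) * prob (?A \<inter> atom J y) \<le> (1 + e)\<^sup>2 * ?p * prob (UNIV \<inter> atom J y) \<and>
     (1 - e)\<^sup>2 * ?p * prob (UNIV \<inter> atom J y) \<le> (1 + e) * prob (?A \<inter> atom J y)" for y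
  proof -
    define J1 where "J1 = {j \<in> J. j < s}"
    define J2 where "J2 = {j \<in> J. \<not> j < s}"
    let ?U = "atom J1 y" and ?V = "atom J2 y"
    have f: "finite J1" "finite J2" using J by (auto simp: J1_def J2_def)
    have R: "atom J y = ?U \<inter> ?V" by (auto simp: atom_def J1_def J2_def)
    have g1: "j + ?n < s" if "j \<in> J1" for j using that gap[of j] by (auto simp: J1_def)
    have g2: "s + 2 * ?n \<le> j" if "j \<in> J2" for j using that gap[of j] by (auto simp: J2_def)
    have g12: "j + ?n + 1 \<le> k" if "j \<in> J1" "k \<in> J2" for j k
      using g1[OF that(1)] g2[OF that(2)] by linarith
    \<comment> \<open>Three comparisons, each across at least n free coordinates: past against
      future, block against future, and past against block with future.\<close>
    have UV: "\<bar>prob (?U \<inter> ?V) - prob ?U * prob ?V\<bar> \<le> e * (prob ?U * prob ?V)"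
      unfolding e_def using f g12 by (intro psi_determined[OF fin, of J1 _ J2] determined_by_atom) auto
    have AV: "\<bar>prob (?A \<inter> ?V) - ?p * prob ?V\<bar> \<le> e * (?p * prob ?V)"
    proof -
      have "j + ?n + 1 \<le> k" if "j \<in> {s..<s + ?n}" "k \<in> J2" for j k
        using that(1) g2[OF that(2)] by auto
      then show ?thesis
        unfolding e_def prob_block[of s as, symmetric] using f
        by (intro psi_determined[OF fin, of "{s..<s + ?n}" _ J2] determined_by_atom determined_by_block) auto
    qed
    have "j + ?n + 1 \<le> k" if "j \<in> J1" "k \<in> {s..<s + ?n} \<union> J2" for j k
      using that(2) g1[OF that(1)] g12[OF that(1), of k] by auto
    then have UAV: "\<bar>prob (?U \<inter> (?A \<inter> ?V)) - prob ?U * prob (?A \<inter> ?V)\<bar> \<le> e * (prob ?U * prob (?A \<inter> ?V))"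
      unfolding e_def using f
      by (intro psi_determined[OF fin, of J1 _ "{s..<s + ?n} \<union> J2"]
            determined_by_atom determined_by_block determined_by_Int) auto
    define u v x z w where "u = prob ?U" and "v = prob ?V" and "x = prob (?A \<inter> ?V)"
      and "z = prob (?U \<inter> (?A \<inter> ?V))" and "w = prob (?U \<inter> ?V)"
    have nn: "u \<ge> 0" "v \<ge> 0" "?p \<ge> 0" by (auto simp: u_def v_def)
    have h1: "(1 - e) * (u * v) \<le> w" "w \<le> (1 + e) * (u * v)"
      using UV unfolding u_def v_def w_def by (auto simp: algebra_simps abs_le_iff)
    have h2: "(1 - e) * (?p * v) \<le> x" "x \<le> (1 + e) * (?p * v)"
      using AV unfolding x_def v_def by (auto simp: algebra_simps abs_le_iff)
    have h3: "(1 - e) * (u * x) \<le> z" "z \<le> (1 + e) * (u * x)"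
      using UAV unfolding u_def x_def z_def by (auto simp: algebra_simps abs_le_iff)
    \<comment> \<open>Detaching the past and then the block costs (1 + e) twice; rejoining past and
      future costs a division by 1 - e, kept here as a factor on the left.\<close>
    have "(1 - e) * z \<le> (1 - e) * ((1 + e) * (u * ((1 + e) * (?p * v))))"
      using h2 h3 nn e0 e1 by (intro mult_left_mono order_trans[OF h3(2)]) auto
    also have "\<dots> = (1 + e)\<^sup>2 * ?p * ((1 - e) * (u * v))" by (simp add: power2_eq_square algebra_simps)
    also have "\<dots> \<le> (1 + e)\<^sup>2 * ?p * w" using h1 nn by (intro mult_left_mono) auto
    finally have r1: "(1 - e) * z \<le> (1 + e)\<^sup>2 * ?p * w" .
    have "(1 - e)\<^sup>2 * ?p * w \<le> (1 - e)\<^sup>2 * ?p * ((1 + e) * (u * v))"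
      using h1 nn by (intro mult_left_mono) auto
    also have "\<dots> = (1 + e) * ((1 - e) * (u * ((1 - e) * (?p * v))))" by (simp add: power2_eq_square algebra_simps)
    also have "\<dots> \<le> (1 + e) * z"
      using h2 h3 nn e0 e1 by (intro mult_left_mono order_trans[OF _ h3(1)]) auto
    finally have r2: "(1 - e)\<^sup>2 * ?p * w \<le> (1 + e) * z" .
    have "?A \<inter> atom J y = ?U \<inter> (?A \<inter> ?V)" unfolding R by auto
    then show ?thesis using r1 r2 unfolding z_def w_def R by simp
  qed
  have "(1 - e) * prob (?A \<inter> (\<Union>y\<in>Y. atom J y)) \<le> (1 + e)\<^sup>2 * ?p * prob (UNIV \<inter> (\<Union>y\<in>Y. atom J y))"
    using both e0 e1 atom_ev block_events space_P sets.top[of P] Y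
    by (intro measure_countable_partition_le) auto
  then show "(1 - e) * prob (?A \<inter> R) \<le> (1 + e)\<^sup>2 * ?p * prob R" using Y by simp
  have "(1 - e)\<^sup>2 * ?p * prob (UNIV \<inter> (\<Union>y\<in>Y. atom J y)) \<le> (1 + e) * prob (?A \<inter> (\<Union>y\<in>Y. atom J y))"
    using both e0 e1 atom_ev block_events space_P sets.top[of P] Y
    by (intro measure_countable_partition_le) auto
  then show "(1 - e)\<^sup>2 * ?p * prob R \<le> (1 + e) * prob (?A \<inter> R)" using Y by simp
qed

text \<open>Induction on the number of blocks: the remaining blocks together with \<open>R\<close>
  again form an event determined by finitely many coordinates, all far from the block being
  removed.\<close>

lemma blocks_interlaced:
  fixes as :: "'a list" and R :: "(nat \<Rightarrow> 'a) set" and s :: "'i \<Rightarrow> nat"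
  defines "e \<equiv> enn2real (psi P (length as))"
  assumes fin: "psi P (length as) < \<infinity>" and e1: "e < 1" and J: "finite J" "determined_by J R"
    and S: "finite S"
    and gap: "\<And>i j. i \<in> S \<Longrightarrow> j \<in> J \<Longrightarrow> j + length as < s i \<or> s i + 2 * length as \<le> j"
    and sep: "\<And>i i'. i \<in> S \<Longrightarrow> i' \<in> S \<Longrightarrow> i \<noteq> i' \<Longrightarrow>
      s i + 2 * length as \<le> s i' \<or> s i' + 2 * length as \<le> s i"
  shows "prob ((\<Inter>i\<in>S. block (s i) as) \<inter> R)
      \<le> ((1 + e)\<^sup>2 / (1 - e)) ^ card S * prob (cylinder as) ^ card S * prob R"
    and "((1 - e)\<^sup>2 / (1 + e)) ^ card S * prob (cylinder as) ^ card S * prob R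
      \<le> prob ((\<Inter>i\<in>S. block (s i) as) \<inter> R)"
proof -
  have e0: "e \<ge> 0" by (simp add: e_def)
  let ?p = "prob (cylinder as)" and ?hi = "(1 + e)\<^sup>2 / (1 - e)" and ?lo = "(1 - e)\<^sup>2 / (1 + e)"
  have "prob ((\<Inter>i\<in>S. block (s i) as) \<inter> R) \<le> ?hi ^ card S * ?p ^ card S * prob R \<and>
    ?lo ^ card S * ?p ^ card S * prob R \<le> prob ((\<Inter>i\<in>S. block (s i) as) \<inter> R)"
    using S gap sep
  proof (induction S rule: finite_induct)
    case (insert a S)
    let ?Q = "(\<Inter>i\<in>S. block (s i) as) \<inter> R" and ?K = "(\<Union>i\<in>S. {s i..<s i + length as}) \<union> J"
    have Q: "determined_by ?K ?Q"
      by (intro determined_by_Int determined_by_INT determined_by_block J)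
    have fK: "finite ?K" using insert J by auto
    have gK: "j + length as < s a \<or> s a + 2 * length as \<le> j" if j: "j \<in> ?K" for j
    proof (cases "j \<in> J")
      case False
      then obtain i where i: "i \<in> S" "j \<in> {s i..<s i + length as}" using j by blast
      then have "i \<noteq> a" using insert by auto
      then have "s i + 2 * length as \<le> s a \<or> s a + 2 * length as \<le> s i" using insert.prems(2)[of i a] i by auto
      then show ?thesis using i by auto
    qed (use insert.prems in auto)
    note one = block_interlaced[OF fin e1[unfolded e_def] fK Q gK, folded e_def]
    have set: "(\<Inter>i\<in>insert a S. block (s i) as) \<inter> R = block (s a) as \<inter> ?Q" by auto
    have IH: "prob ?Q \<le> ?hi ^ card S * ?p ^ card S * prob R"
        "?lo ^ card S * ?p ^ card S * prob R \<le> prob ?Q"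
      using insert by auto
    have "prob (block (s a) as \<inter> ?Q) \<le> ?hi * ?p * prob ?Q"
      using one(1) e1 by (simp add: field_simps)
    also have "\<dots> \<le> ?hi * ?p * (?hi ^ card S * ?p ^ card S * prob R)"
      using IH e0 e1 by (intro mult_left_mono) auto
    finally have u: "prob (block (s a) as \<inter> ?Q) \<le> ?hi ^ card (insert a S) * ?p ^ card (insert a S) * prob R"
      using insert by (simp add: ac_simps)
    have "?lo * ?p * (?lo ^ card S * ?p ^ card S * prob R) \<le> ?lo * ?p * prob ?Q"
      using IH e0 e1 by (intro mult_left_mono) auto
    also have "\<dots> \<le> prob (block (s a) as \<inter> ?Q)"
      using one(2) e0 by (simp add: field_simps)
    finally have l: "?lo ^ card (insert a S) * ?p ^ card (insert a S) * prob R \<le> prob (block (s a) as \<inter> ?Q)"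
      using insert by (simp add: ac_simps)
    show ?case unfolding set using u l by blast
  qed simp
  from conjunct1[OF this] conjunct2[OF this]
  show "prob ((\<Inter>i\<in>S. block (s i) as) \<inter> R) \<le> ?hi ^ card S * ?p ^ card S * prob R"
    "?lo ^ card S * ?p ^ card S * prob R \<le> prob ((\<Inter>i\<in>S. block (s i) as) \<inter> R)" .
qed

end

subsection \<open>Multiple hits\<close>

text \<open>The event whose indicator is the multiple hit of \<open>cylinder as\<close>; in this
  form the hit count is a cardinality, as in \<open>chen_stein_poisson\<close>.\<close>

definition joint_block :: "nat \<Rightarrow> (nat \<Rightarrow> nat \<Rightarrow> nat) \<Rightarrow> 'a list \<Rightarrow> nat \<Rightarrow> (nat \<Rightarrow> 'a) set" where
  "joint_block l q as k = (\<Inter>i\<in>{1..l}. block (q i k) as)"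

lemma multi_hit_cylinder: "multi_hit l q (cylinder as) k \<omega> = indicator (joint_block l q as k) \<omega>"
proof -
  have "(left_shift ^^ s) \<omega> \<in> cylinder as \<longleftrightarrow> \<omega> \<in> block s as" for s
    by (simp add: shift_iterate cylinder_def block_def)
  then have "multi_hit l q (cylinder as) k \<omega> = (\<Prod>i = 1..l. if \<omega> \<in> block (q i k) as then 1 else 0)"
    by (simp add: multi_hit_def indicator_def of_bool_def)
  also have "\<dots> = indicator (joint_block l q as k) \<omega>"
  proof (cases "\<omega> \<in> joint_block l q as k")
    case True
    then show ?thesis by (simp add: joint_block_def)
  next
    case False
    then obtain i where "i \<in> {1..l}" "\<omega> \<notin> block (q i k) as" by (auto simp: joint_block_def)
    then have "(\<Prod>i = 1..l. if \<omega> \<in> block (q i k) as then 1 else 0 :: nat) = 0"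
      by (intro prod_zero) auto
    then show ?thesis using False by simp
  qed
  finally show ?thesis .
qed

lemma hit_count_cylinder:
  "hit_count l q (cylinder as) N \<omega> = card {k \<in> {1..N}. \<omega> \<in> joint_block l q as k}"
  unfolding hit_count_def multi_hit_cylinder
  by (simp add: indicator_def of_bool_def sum.If_cases Int_def)

lemma determined_by_joint_block:
  "determined_by (\<Union>i\<in>{1..l}. {q i k..<q i k + length as}) (joint_block l q as k)"
  unfolding joint_block_def by (intro determined_by_INT determined_by_block)

lemma determined_by_card_joint_block:
  "determined_by (\<Union>k\<in>K. \<Union>i\<in>{1..l}. {q i k..<q i k + length as})
     {\<omega>. card {k \<in> K. \<omega> \<in> joint_block l q as k} \<in> L}"
  unfolding determined_by_def
proof (intro allI impI)
  fix \<omega> \<omega>' :: "nat \<Rightarrow> 'a"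
  assume eq: "\<forall>j\<in>(\<Union>k\<in>K. \<Union>i\<in>{1..l}. {q i k..<q i k + length as}). \<omega> j = \<omega>' j"
    and \<omega>: "\<omega> \<in> {\<omega>. card {k \<in> K. \<omega> \<in> joint_block l q as k} \<in> L}"
  have "\<omega> \<in> joint_block l q as k \<longleftrightarrow> \<omega>' \<in> joint_block l q as k" if k: "k \<in> K" for k
  proof -
    have "\<forall>m\<in>(\<Union>i\<in>{1..l}. {q i k..<q i k + length as}). \<omega> m = \<omega>' m"
      using eq k by blast
    then show ?thesis
      using determined_by_joint_block[of q k as l] unfolding determined_by_def by metis
  qed
  then have "{k \<in> K. \<omega> \<in> joint_block l q as k} = {k \<in> K. \<omega>' \<in> joint_block l q as k}" by blast
  then show "\<omega>' \<in> {\<omega>. card {k \<in> K. \<omega> \<in> joint_block l q as k} \<in> L}" using \<omega> by simp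
qed

text \<open>The values of \<open>g\<close> are distinct integers in a window around x of length at
  most 2 m; truncated subtraction can only shorten the window.\<close>

lemma card_near_le:
  fixes g :: "'i \<Rightarrow> nat"
  assumes "inj_on g I" "finite I"
  shows "card {j \<in> I. x < g j + m \<and> g j < x + m} \<le> 2 * m"
proof -
  have "card {j \<in> I. x < g j + m \<and> g j < x + m} = card (g ` {j \<in> I. x < g j + m \<and> g j < x + m})"
    using assms by (intro card_image[symmetric]) (auto intro: inj_on_subset)
  also have "\<dots> \<le> card {x - m..<x + m}" by (intro card_mono) auto
  finally show ?thesis by simp
qed

context shift_invariant
begin

lemma joint_block_events: "joint_block l q as k \<in> events"
  by (rule determined_by_events[OF _ determined_by_joint_block]) simp

lemma prob_joint_block_le:
  assumes "l \<ge> 1"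
  shows "prob (joint_block l q as k) \<le> prob (cylinder as)"
proof -
  have "prob (joint_block l q as k) \<le> prob (block (q 1 k) as)"
    using assms by (intro finite_measure_mono block_events) (auto simp: joint_block_def)
  then show ?thesis by (simp add: prob_block)
qed

text \<open>The Chen-Stein bound with a = p^l. Here c is the relative error of detaching all l
  blocks and r bounds the probability of two distinct hits.\<close>

lemma poisson_joint_block:
  fixes as :: "'a list" and l :: nat and q :: "nat \<Rightarrow> nat \<Rightarrow> nat" and I :: "nat set" and t c r :: real
  defines "n \<equiv> length as" and "e \<equiv> enn2real (psi P (length as))" and "p \<equiv> prob (cylinder as)"
  assumes n: "n \<ge> 1" and l: "l \<ge> 1" and t: "t > 0"
    and fin: "psi P n < \<infinity>" and e1: "e < 1"
    and hi: "((1 + e)\<^sup>2 / (1 - e)) ^ l \<le> 1 + c" and lo: "1 - c \<le> ((1 - e)\<^sup>2 / (1 + e)) ^ l"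
    and I: "finite I"
    and sep: "\<And>k i i'. k \<in> I \<Longrightarrow> i \<in> {1..l} \<Longrightarrow> i' \<in> {1..l} \<Longrightarrow> i < i' \<Longrightarrow> q i k + 2 * n \<le> q i' k"
    and inj: "\<And>i. i \<in> {1..l} \<Longrightarrow> inj_on (q i) I"
    and pair: "\<And>k j. k \<in> I \<Longrightarrow> j \<in> I \<Longrightarrow> k \<noteq> j \<Longrightarrow> prob (joint_block l q as k \<inter> joint_block l q as j) \<le> r"
    and r: "r \<ge> 0"
  shows "\<bar>prob {\<omega>. card {k \<in> I. \<omega> \<in> joint_block l q as k} \<in> L} - measure (poisson_pmf t) L\<bar>
    \<le> \<bar>t - real (card I) * p ^ l\<bar> + real (card I) * (c * p ^ l)
      + 2 * (real (card I) * (4 * real n * (real l)\<^sup>2 * (p ^ l * p + r)))"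
proof -
  let ?X = "joint_block l q as"
  \<comment> \<open>Blocks have length n, so starting points at distance at least 2 n leave n free
    coordinates between them.\<close>
  define B where "B k = {j \<in> I. \<exists>i\<in>{1..l}. \<exists>i'\<in>{1..l}. q i k < q i' j + 2 * n \<and> q i' j < q i k + 2 * n}" for k
  have p0: "p \<ge> 0" by (simp add: p_def)
  have B_sub: "B k \<subseteq> I" for k by (auto simp: B_def)
  have B_self: "k \<in> B k" if "k \<in> I" for k using that l n by (auto simp: B_def intro!: bexI[of _ 1])
  \<comment> \<open>There are l^2 pairs of block indices, and each admits at most 2 (2 n) values of
    j because every \<open>q i'\<close> is injective on I.\<close>
  have card_B: "real (card (B k)) \<le> 4 * real n * (real l)\<^sup>2" for k
  proof -
    let ?F = "\<lambda>i i'. {j \<in> I. q i k < q i' j + 2 * n \<and> q i' j < q i k + 2 * n}"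
    have "B k = (\<Union>i\<in>{1..l}. \<Union>i'\<in>{1..l}. ?F i i')" unfolding B_def by blast
    then have "card (B k) \<le> (\<Sum>i\<in>{1..l}. card (\<Union>i'\<in>{1..l}. ?F i i'))"
      by (simp only:) (rule card_UN_le, simp)
    also have "\<dots> \<le> (\<Sum>i\<in>{1..l}. \<Sum>i'\<in>{1..l}. card (?F i i'))"
      by (rule sum_mono, rule card_UN_le) simp
    also have "\<dots> \<le> (\<Sum>i\<in>{1..l}. \<Sum>i'\<in>{1..l}. 2 * (2 * n))"
      by (rule sum_mono, rule sum_mono, rule card_near_le) (use inj I in auto)
    also have "\<dots> = 4 * n * l\<^sup>2" by (simp add: power2_eq_square)
    finally show ?thesis by (metis of_nat_mono of_nat_mult of_nat_numeral of_nat_power)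
  qed
  have prob_X: "prob (?X j) \<le> p" for j
    unfolding p_def using l by (rule prob_joint_block_le)
  have far: "\<bar>prob (?X k \<inter> {\<omega> \<in> space P. card {j \<in> I - B k. \<omega> \<in> ?X j} = w})
        - p ^ l * prob {\<omega> \<in> space P. card {j \<in> I - B k. \<omega> \<in> ?X j} = w}\<bar>
      \<le> c * p ^ l * prob {\<omega> \<in> space P. card {j \<in> I - B k. \<omega> \<in> ?X j} = w}" if k: "k \<in> I" for k w
  proof -
    let ?R = "{\<omega> \<in> space P. card {j \<in> I - B k. \<omega> \<in> ?X j} = w}"
    let ?J = "\<Union>j\<in>I - B k. \<Union>i\<in>{1..l}. {q i j..<q i j + length as}"
    have J: "finite ?J" using I by auto
    have R: "determined_by ?J ?R"
      using determined_by_card_joint_block[of q as l "I - B k" "{w}"] by (simp add: space_P)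
    have gap: "m + length as < q i k \<or> q i k + 2 * length as \<le> m" if i: "i \<in> {1..l}" and m: "m \<in> ?J" for i m
    proof -
      obtain j i' where ji: "j \<in> I - B k" "i' \<in> {1..l}" "q i' j \<le> m" "m < q i' j + length as"
        using m by auto
      then have "\<not> (q i k < q i' j + 2 * n \<and> q i' j < q i k + 2 * n)"
        using i by (auto simp: B_def)
      then show ?thesis using ji by (auto simp: n_def)
    qed
    have sep': "q i k + 2 * length as \<le> q i' k \<or> q i' k + 2 * length as \<le> q i k"
      if "i \<in> {1..l}" "i' \<in> {1..l}" "i \<noteq> i'" for i i'
      using sep[OF k that(1,2)] sep[OF k that(2,1)] that(3) unfolding n_def by linarith
    have S: "finite {1..l}" "card {1..l} = l" by auto
    have "prob (?X k \<inter> ?R) \<le> ((1 + e)\<^sup>2 / (1 - e)) ^ l * p ^ l * prob ?R"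
      and "((1 - e)\<^sup>2 / (1 + e)) ^ l * p ^ l * prob ?R \<le> prob (?X k \<inter> ?R)"
      using blocks_interlaced[OF fin[unfolded n_def] e1[unfolded e_def] J R S(1), of "\<lambda>i. q i k", OF gap sep']
      unfolding joint_block_def e_def p_def S(2) by blast+
    moreover have "((1 + e)\<^sup>2 / (1 - e)) ^ l * p ^ l * prob ?R \<le> (1 + c) * p ^ l * prob ?R"
      using hi p0 by (intro mult_right_mono) auto
    moreover have "(1 - c) * p ^ l * prob ?R \<le> ((1 - e)\<^sup>2 / (1 + e)) ^ l * p ^ l * prob ?R"
      using lo p0 by (intro mult_right_mono) auto
    ultimately show ?thesis by (simp add: abs_le_iff algebra_simps)
  qed
  have sum_bound: "p ^ l * (\<Sum>j\<in>B k. prob (?X j)) + (\<Sum>j\<in>B k - {k}. prob (?X k \<inter> ?X j))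
      \<le> 4 * real n * (real l)\<^sup>2 * (p ^ l * p + r)" if k: "k \<in> I" for k
  proof -
    have fB: "finite (B k)" using B_sub I finite_subset by blast
    have "(\<Sum>j\<in>B k. prob (?X j)) \<le> real (card (B k)) * p"
      using sum_bounded_above[of "B k" "\<lambda>j. prob (?X j)" p] prob_X by simp
    then have 1: "p ^ l * (\<Sum>j\<in>B k. prob (?X j)) \<le> real (card (B k)) * (p ^ l * p)"
      using mult_left_mono[of _ _ "p ^ l"] p0 by (simp add: mult.left_commute)
    have "(\<Sum>j\<in>B k - {k}. prob (?X k \<inter> ?X j)) \<le> real (card (B k - {k})) * r"
      using sum_bounded_above[of "B k - {k}" "\<lambda>j. prob (?X k \<inter> ?X j)" r] pair[OF k] B_sub by blast
    also have "\<dots> \<le> real (card (B k)) * r"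
      using r fB by (intro mult_right_mono) (auto intro: card_mono)
    finally have "p ^ l * (\<Sum>j\<in>B k. prob (?X j)) + (\<Sum>j\<in>B k - {k}. prob (?X k \<inter> ?X j))
        \<le> real (card (B k)) * (p ^ l * p + r)" using 1 by (simp add: algebra_simps)
    also have "\<dots> \<le> 4 * real n * (real l)\<^sup>2 * (p ^ l * p + r)"
      using p0 r by (intro mult_right_mono card_B) auto
    finally show ?thesis .
  qed
  have "\<bar>prob {\<omega> \<in> space P. card {k \<in> I. \<omega> \<in> ?X k} \<in> L} - measure (poisson_pmf t) L\<bar>
    \<le> \<bar>t - real (card I) * p ^ l\<bar> + real (card I) * (c * p ^ l)
      + 2 * (\<Sum>k\<in>I. p ^ l * (\<Sum>j\<in>B k. prob (?X j)) + (\<Sum>j\<in>B k - {k}. prob (?X k \<inter> ?X j)))"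
    using I joint_block_events t p0 B_sub B_self far by (intro chen_stein_poisson) auto
  also have "(\<Sum>k\<in>I. p ^ l * (\<Sum>j\<in>B k. prob (?X j)) + (\<Sum>j\<in>B k - {k}. prob (?X k \<inter> ?X j)))
      \<le> real (card I) * (4 * real n * (real l)\<^sup>2 * (p ^ l * p + r))"
    using sum_bound by (intro sum_bounded_above) auto
  finally show ?thesis by (simp add: space_P)
qed

lemma prob_Int_after:
  assumes fin: "psi P 0 < \<infinity>" and J: "finite J" "determined_by J R" and gap: "\<And>j. j \<in> J \<Longrightarrow> j < s"
  shows "prob (R \<inter> block s bs) \<le> (1 + enn2real (psi P 0)) * prob R * prob (cylinder bs)"
proof -
  have "\<bar>prob (R \<inter> block s bs) - prob R * prob (block s bs)\<bar>
      \<le> enn2real (psi P 0) * (prob R * prob (block s bs))"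
    \<comment> \<open>With no free coordinates guaranteed, only the coefficient at distance 0 is
      available. This is the source of the factor 1 + \<psi>(0) in the final estimate.\<close>
    using J gap by (intro psi_determined[OF fin, of J _ "{s..<s + length bs}"] determined_by_block)
      (auto simp: Suc_le_eq intro: less_le_trans)
  then show ?thesis by (simp add: prob_block algebra_simps)
qed

text \<open>Let d be the distance between the last blocks of the two hits. After everything read by
  the earlier hit there follows the whole word if d \<ge> n, and its last d letters otherwise;
  either has probability at most b e^(-\<Gamma> n).\<close>

lemma prob_two_joint_blocks:
  fixes as :: "'a list" and \<Gamma> b :: real
  defines "n \<equiv> length as"
  assumes l: "l \<ge> 1" and fin: "psi P 0 < \<infinity>" and n: "n \<ge> 1"
    and decay: "\<And>bs :: 'a list. length bs \<ge> 1 \<Longrightarrow> prob (cylinder bs) \<le> exp (- \<Gamma> * real (length bs))"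
    and per: "\<And>d. 1 \<le> d \<Longrightarrow> d < n \<Longrightarrow> (\<And>i. i < n - d \<Longrightarrow> as ! (i + d) = as ! i) \<Longrightarrow> exp (\<Gamma> * real (n - d)) \<le> b"
    and b: "b \<ge> 1"
    and sep: "\<And>i. i \<in> {1..<l} \<Longrightarrow> q i k \<le> q l k" and lt: "q l k < q l j"
  shows "prob (joint_block l q as k \<inter> joint_block l q as j)
    \<le> (1 + enn2real (psi P 0)) * prob (joint_block l q as k) * (b * exp (- \<Gamma> * real n))"
proof (cases "joint_block l q as k \<inter> joint_block l q as j = {}")
  case True
  then show ?thesis using b by simp
next
  case False
  \<comment> \<open>A common point is needed only to show that the word has period d when the last
    blocks overlap.\<close>
  then obtain \<omega> where "\<omega> \<in> joint_block l q as k" "\<omega> \<in> joint_block l q as j" by blast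
  then have \<omega>: "\<omega> \<in> block (q l k) as" "\<omega> \<in> block (q l j) as" using l by (auto simp: joint_block_def)
  define d where "d = q l j - q l k"
  have d: "q l j = q l k + d" "d \<ge> 1" using lt by (auto simp: d_def)
  obtain s bs where s: "q l k + n \<le> s" and bs: "block (q l k) as \<inter> block (q l j) as \<subseteq> block s bs"
    and pb: "prob (cylinder bs) \<le> b * exp (- \<Gamma> * real n)"
  proof (cases "d < n")
    case False
    have "prob (cylinder as) \<le> 1 * exp (- \<Gamma> * real n)" using decay[of as] n by (simp add: n_def)
    also have "\<dots> \<le> b * exp (- \<Gamma> * real n)" using b by (intro mult_right_mono) auto
    finally show ?thesis using False d that[of "q l j" as] by auto
  next
    case True
    \<comment> \<open>The part of the later block that sticks out beyond the earlier one.\<close>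
    let ?bs = "drop (n - d) as"
    have per_d: "as ! (i + d) = as ! i" if "i < n - d" for i
    proof -
      have "i + d < length as" "i < length as" using that by (auto simp: n_def)
      then have "\<omega> (q l k + (i + d)) = as ! (i + d)" "\<omega> (q l j + i) = as ! i"
        using \<omega> unfolding block_def by blast+
      then show ?thesis by (simp add: d ac_simps)
    qed
    have sub: "block (q l k) as \<inter> block (q l j) as \<subseteq> block (q l k + n) ?bs"
    proof
      fix x assume x: "x \<in> block (q l k) as \<inter> block (q l j) as"
      show "x \<in> block (q l k + n) ?bs"
        unfolding block_def
      proof (intro CollectI allI impI)
        fix i assume i: "i < length ?bs"
        then have "n - d + i < length as" using True by (auto simp: n_def)
        then have "x (q l j + (n - d + i)) = as ! (n - d + i)" using x unfolding block_def by blast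
        moreover have "q l j + (n - d + i) = q l k + n + i" using True d by simp
        ultimately have "x (q l k + n + i) = as ! (n - d + i)" by metis
        then show "x (q l k + n + i) = ?bs ! i" by (simp add: n_def)
      qed
    qed
    have len: "length ?bs = d" using True by (simp add: n_def)
    have "prob (cylinder ?bs) \<le> exp (- \<Gamma> * real d)" using decay[of ?bs] d len by (simp only:)
    \<comment> \<open>The decay available is only e^(-\<Gamma> d); \<open>per\<close> bounds the
      missing factor by b.\<close>
    also have "\<dots> = exp (\<Gamma> * real (n - d)) * exp (- \<Gamma> * real n)"
      using True by (simp add: mult_exp_exp of_nat_diff algebra_simps)
    also have "\<dots> \<le> b * exp (- \<Gamma> * real n)"
      using per[OF d(2) True per_d] by (intro mult_right_mono) auto
    finally show ?thesis using sub that[of "q l k + n" ?bs] by simp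
  qed
  have "m < s" if m: "m \<in> (\<Union>i\<in>{1..l}. {q i k..<q i k + length as})" for m
  proof -
    obtain i where "i \<in> {1..l}" "m < q i k + n" using m by (auto simp: n_def)
    moreover from this have "q i k \<le> q l k" using sep[of i] by (cases "i = l") auto
    ultimately show ?thesis using s by linarith
  qed
  then have "prob (joint_block l q as k \<inter> block s bs)
      \<le> (1 + enn2real (psi P 0)) * prob (joint_block l q as k) * prob (cylinder bs)"
    by (intro prob_Int_after[OF fin _ determined_by_joint_block]) auto
  also have "\<dots> \<le> (1 + enn2real (psi P 0)) * prob (joint_block l q as k) * (b * exp (- \<Gamma> * real n))"
    using pb by (intro mult_left_mono) auto
  finally have "prob (joint_block l q as k \<inter> block s bs)
      \<le> (1 + enn2real (psi P 0)) * prob (joint_block l q as k) * (b * exp (- \<Gamma> * real n))" .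
  moreover have "prob (joint_block l q as k \<inter> joint_block l q as j) \<le> prob (joint_block l q as k \<inter> block s bs)"
  proof (intro finite_measure_mono subsetI)
    fix x assume "x \<in> joint_block l q as k \<inter> joint_block l q as j"
    then have "x \<in> joint_block l q as k" "x \<in> block (q l k) as \<inter> block (q l j) as"
      using l by (auto simp: joint_block_def)
    then show "x \<in> joint_block l q as k \<inter> block s bs" using bs by blast
  qed (use joint_block_events block_events in auto)
  ultimately show ?thesis by linarith
qed

text \<open>Once the first d letters are known, the next n - d are forced. The bound for this
  continuation is uniform over the atoms of the first d coordinates and is summed over them.\<close>

lemma prob_periodic_le:
  fixes \<Gamma> :: real
  assumes fin: "psi P 0 < \<infinity>" and d: "1 \<le> d" "d < n"
    and decay: "\<And>bs :: 'a list. length bs \<ge> 1 \<Longrightarrow> prob (cylinder bs) \<le> exp (- \<Gamma> * real (length bs))"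
  shows "{\<omega>. \<forall>i < n - d. \<omega> (i + d) = \<omega> i} \<in> events"
    and "prob {\<omega>. \<forall>i < n - d. \<omega> (i + d) = \<omega> i} \<le> (1 + enn2real (psi P 0)) * exp (- \<Gamma> * real (n - d))"
proof -
  let ?E = "{\<omega> :: nat \<Rightarrow> 'a. \<forall>i < n - d. \<omega> (i + d) = \<omega> i}" and ?c = "1 + enn2real (psi P 0)"
  have "determined_by {..<n} ?E" by (auto simp: determined_by_def)
  then show ev: "?E \<in> events" by (intro determined_by_events) auto
  have U: "determined_by {..<d} (UNIV :: (nat \<Rightarrow> 'a) set)" by (simp add: determined_by_def)
  obtain Y :: "(nat \<Rightarrow> 'a) set" where Y: "countable Y" "disjoint_family_on (atom {..<d}) Y"
      "UNIV = (\<Union>y\<in>Y. atom {..<d} y)"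
    using determined_by_countable_partition[OF _ U] by blast
  have at: "atom {..<d} y \<in> events" for y
    by (intro determined_by_events[OF _ determined_by_atom]) auto
  have le: "1 * prob (?E \<inter> atom {..<d} y) \<le> ?c * exp (- \<Gamma> * real (n - d)) * prob (UNIV \<inter> atom {..<d} y)" for y
  proof -
    \<comment> \<open>The periodic continuation of the first d letters of \<open>y\<close>.\<close>
    let ?bs = "map (\<lambda>i. y (i mod d)) [d..<n]"
    have "?E \<inter> atom {..<d} y \<subseteq> atom {..<d} y \<inter> block d ?bs"
    proof
      fix \<omega> assume \<omega>: "\<omega> \<in> ?E \<inter> atom {..<d} y"
      have "i < n \<longrightarrow> \<omega> i = y (i mod d)" for i
      proof (induction i rule: less_induct)
        case (less i)
        show ?case
        proof (cases "i < d")
          case True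
          then show ?thesis using \<omega> by (simp add: atom_def)
        next
          case False
          show ?thesis
          proof
            assume "i < n"
            then have "i - d < n - d" using False d by linarith
            then have "\<omega> (i - d + d) = \<omega> (i - d)" using \<omega> by blast
            also have "\<dots> = y ((i - d) mod d)" using less[of "i - d"] False d \<open>i < n\<close> by simp
            finally show "\<omega> i = y (i mod d)" using False by (simp add: le_mod_geq)
          qed
        qed
      qed
      then show "\<omega> \<in> atom {..<d} y \<inter> block d ?bs" using \<omega> by (auto simp: block_def)
    qed
    then have "prob (?E \<inter> atom {..<d} y) \<le> prob (atom {..<d} y \<inter> block d ?bs)"
      using at block_events by (intro finite_measure_mono) auto
    also have "\<dots> \<le> ?c * prob (atom {..<d} y) * prob (cylinder ?bs)"
      by (intro prob_Int_after[OF fin _ determined_by_atom]) auto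
    also have "\<dots> \<le> ?c * prob (atom {..<d} y) * exp (- \<Gamma> * real (n - d))"
      using decay[of ?bs] d by (intro mult_left_mono) auto
    finally show ?thesis by (simp add: ac_simps)
  qed
  have "1 * prob (?E \<inter> (\<Union>y\<in>Y. atom {..<d} y))
      \<le> ?c * exp (- \<Gamma> * real (n - d)) * prob (UNIV \<inter> (\<Union>y\<in>Y. atom {..<d} y))"
    using Y(1,2) at ev le sets.top[of P]
    by (intro measure_countable_partition_le) (auto simp: space_P)
  then show "prob ?E \<le> ?c * exp (- \<Gamma> * real (n - d))"
    using prob_space unfolding Y(3)[symmetric] by (simp add: space_P)
qed

text \<open>Borel-Cantelli. Each forbidden period has probability of order n^(-3) and there are
  fewer than n of them for n \<ge> 1, so the exponent 3 leaves the summable bound n^(-2).\<close>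

lemma AE_no_short_period:
  fixes \<Gamma> :: real
  assumes fin: "psi P 0 < \<infinity>"
    and decay: "\<And>bs :: 'a list. length bs \<ge> 1 \<Longrightarrow> prob (cylinder bs) \<le> exp (- \<Gamma> * real (length bs))"
  shows "AE \<omega> in P. \<forall>\<^sub>F n in sequentially. \<forall>d. 1 \<le> d \<longrightarrow> d < n \<longrightarrow>
    (\<forall>i < n - d. \<omega> (i + d) = \<omega> i) \<longrightarrow> exp (\<Gamma> * real (n - d)) \<le> real n ^ 3"
proof -
  let ?E = "\<lambda>n d. {\<omega> :: nat \<Rightarrow> 'a. \<forall>i < n - d. \<omega> (i + d) = \<omega> i}" and ?c = "1 + enn2real (psi P 0)"
  define D where "D n = {d \<in> {1..<n}. real n ^ 3 < exp (\<Gamma> * real (n - d))}" for n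
  define A where "A n = (\<Union>d\<in>D n. ?E n d)" for n
  have E_ev: "?E n d \<in> events" if "d \<in> D n" for n d
    using that prob_periodic_le(1)[OF fin _ _ decay] by (auto simp: D_def)
  have A_ev: "A n \<in> events" for n
    unfolding A_def using E_ev by (intro sets.finite_UN) (auto simp: D_def)
  \<comment> \<open>The case n = 0 is included: \<open>D 0\<close> is empty and division by 0 gives
    0.\<close>
  have bound: "prob (A n) \<le> ?c * (1 / real n ^ 2)" for n
  proof -
    have fD: "finite (D n)" by (simp add: D_def)
    have "prob (A n) \<le> (\<Sum>d\<in>D n. prob (?E n d))"
      unfolding A_def using fD E_ev by (intro finite_measure_subadditive_finite) auto
    also have "\<dots> \<le> (\<Sum>d\<in>D n. ?c * (1 / real n ^ 3))"
    proof (intro sum_mono)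
      fix d assume d: "d \<in> D n"
      have "prob (?E n d) \<le> ?c * exp (- \<Gamma> * real (n - d))"
        using d prob_periodic_le(2)[OF fin _ _ decay] by (auto simp: D_def)
      also have "exp (- \<Gamma> * real (n - d)) = 1 / exp (\<Gamma> * real (n - d))"
        by (simp add: exp_minus field_simps)
      also have "\<dots> \<le> 1 / real n ^ 3"
        using d by (intro divide_left_mono) (auto simp: D_def)
      finally show "prob (?E n d) \<le> ?c * (1 / real n ^ 3)" by (simp add: mult_left_mono)
    qed
    also have "\<dots> = real (card (D n)) * (?c * (1 / real n ^ 3))" by simp
    also have "\<dots> \<le> real n * (?c * (1 / real n ^ 3))"
    proof (intro mult_right_mono)
      have "card (D n) \<le> card {1..<n}" unfolding D_def by (intro card_mono) auto
      then show "real (card (D n)) \<le> real n" by simp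
    qed auto
    also have "\<dots> = ?c * (1 / real n ^ 2)" by (simp add: power2_eq_square power3_eq_cube)
    finally show ?thesis .
  qed
  have "summable (\<lambda>n. ?c * (1 / real n ^ 2))"
    using inverse_power_summable[of 2, where ?'a = real] by (intro summable_mult) (simp add: inverse_eq_divide)
  then have "summable (\<lambda>n. prob (A n))"
    by (rule summable_comparison_test'[of _ 0]) (use bound in auto)
  then have "AE \<omega> in P. \<forall>\<^sub>F n in sequentially. \<omega> \<in> space P - A n"
    using A_ev by (intro borel_cantelli_AE1) (auto simp: emeasure_eq_measure)
  then show ?thesis
  proof (eventually_elim)
    case (elim \<omega>)
    then show ?case
    proof (eventually_elim)
      case (elim n)
      show ?case
      proof (intro allI impI)
        fix d assume "1 \<le> d" "d < n" "\<forall>i < n - d. \<omega> (i + d) = \<omega> i"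
        moreover have "d \<notin> D n" using elim calculation(3) unfolding A_def by blast
        ultimately show "exp (\<Gamma> * real (n - d)) \<le> real n ^ 3"
          unfolding D_def by (simp add: not_less del: of_nat_diff)
      qed
    qed
  qed
qed

text \<open>There are countably many finite words, so the cylinders of probability 0 together form a
  null set.\<close>

lemma AE_cylinder_at_pos: "AE \<omega> in P. \<forall>n. prob (cylinder_at \<omega> n) > 0"
proof (subst AE_all_countable, rule allI)
  fix n
  let ?Z = "\<Union>as\<in>{as :: 'a list. prob (cylinder as) = 0}. cylinder as"
  have "?Z \<in> null_sets P"
    using block_events[of 0] unfolding block_0
    by (intro null_sets_UN') (auto simp: null_sets_def emeasure_eq_measure)
  moreover have "\<omega> \<in> cylinder_at \<omega> n" for \<omega> :: "nat \<Rightarrow> 'a" by (simp add: cylinder_at_def cylinder_def)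
  then have "{\<omega> \<in> space P. \<not> prob (cylinder_at \<omega> n) > 0} \<subseteq> ?Z"
    by (auto simp: cylinder_at_def zero_less_measure_iff)
  ultimately show "AE \<omega> in P. prob (cylinder_at \<omega> n) > 0" by (rule AE_I')
qed

end

text \<open>
  Both sides agree at \<open>0\<close>, and their derivatives there differ by \<open>2\<^sup>l\<^sup>+\<^sup>1 - 3 l > 0\<close>.
\<close>

lemma eventually_power_ratio_le:
  fixes \<psi> :: "nat \<Rightarrow> real"
  assumes l: "l \<ge> 1" and nn: "\<And>n. \<psi> n \<ge> 0" and lim: "\<psi> \<longlonglongrightarrow> 0"
  shows "\<forall>\<^sub>F n in sequentially. \<psi> n < 1 \<and> 2 ^ (l + 1) * \<psi> n \<le> 1
    \<and> ((1 + \<psi> n)\<^sup>2 / (1 - \<psi> n)) ^ l \<le> 1 + 2 ^ (l + 1) * \<psi> n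
    \<and> 1 - 2 ^ (l + 1) * \<psi> n \<le> ((1 - \<psi> n)\<^sup>2 / (1 + \<psi> n)) ^ l"
proof -
  \<comment> \<open>Equality of orders is narrowly avoided at l = 1, where 3 < 4; each further step
    adds 3 on the left and at least 4 on the right.\<close>
  have 3: "3 * real l < 2 ^ (l + 1)"
    using l
  proof (induction l rule: dec_induct)
    case (step m)
    have "(2::real) ^ 2 \<le> 2 ^ (m + 1)" using step by (intro power_increasing) auto
    then show ?case using step by simp
  qed simp
  let ?f = "\<lambda>x::real. 1 + 2 ^ (l + 1) * x - ((1 + x)\<^sup>2 / (1 - x)) ^ l"
  let ?g = "\<lambda>x::real. ((1 - x)\<^sup>2 / (1 + x)) ^ l - (1 - 2 ^ (l + 1) * x)"
  have "(?f has_real_derivative 2 ^ (l + 1) - 3 * real l) (at 0)"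
    by (auto intro!: derivative_eq_intros simp: power2_eq_square)
  from DERIV_pos_inc_right[OF this] 3 obtain \<delta>1 where d1: "\<delta>1 > 0" "\<And>h. 0 < h \<Longrightarrow> h < \<delta>1 \<Longrightarrow> ?f 0 < ?f (0 + h)"
    by auto
  have "(?g has_real_derivative 2 ^ (l + 1) - 3 * real l) (at 0)"
    by (auto intro!: derivative_eq_intros simp: power2_eq_square)
  from DERIV_pos_inc_right[OF this] 3 obtain \<delta>2 where d2: "\<delta>2 > 0" "\<And>h. 0 < h \<Longrightarrow> h < \<delta>2 \<Longrightarrow> ?g 0 < ?g (0 + h)"
    by auto
  have "\<forall>\<^sub>F n in sequentially. \<psi> n < min (min \<delta>1 \<delta>2) (1 / 2 ^ (l + 1))"
    using d1 d2 by (intro order_tendstoD(2)[OF lim]) auto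
  then show ?thesis
  proof eventually_elim
    case (elim n)
    have small: "2 ^ (l + 1) * \<psi> n \<le> 1" using elim by (simp add: field_simps)
    have "(1::real) < 2 ^ (l + 1)" by (intro one_less_power) auto
    then have "1 / 2 ^ (l + 1) < (1::real)" by simp
    then have "\<psi> n < 1" using elim by linarith
    \<comment> \<open>The derivative argument covers only positive arguments, so \<psi>(n) = 0 is
      separate.\<close>
    then show ?case using small d1(2)[of "\<psi> n"] d2(2)[of "\<psi> n"] elim nn[of n]
      by (cases "\<psi> n = 0") (auto simp: less_le)
  qed
qed

text \<open>Since \<open>gap\<close> is an infimum over all later k, the bound at
  \<open>gap_time\<close> holds from there on.\<close>

lemma gap_time_separation:
  assumes q_less: "\<And>i k. i \<in> {1..<l} \<Longrightarrow> k \<ge> 1 \<Longrightarrow> q i k < q (i + 1) k"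
    and q_gap: "\<And>i. i \<in> {1..<l} \<Longrightarrow> filterlim (\<lambda>k. q (i + 1) k - q i k) at_top at_top"
    and k: "k \<ge> 1" "gap_time l q n \<le> k" and i: "1 \<le> i" "i < i'" "i' \<le> l"
  shows "q i k + 2 * n \<le> q i' k"
proof -
  have "\<forall>\<^sub>F k in sequentially. \<forall>i\<in>{1..<l}. 2 * n \<le> q (i + 1) k - q i k"
    using q_gap by (intro eventually_ball_finite ballI) (auto simp: filterlim_at_top)
  then obtain K where K: "\<And>k i. k \<ge> K \<Longrightarrow> i \<in> {1..<l} \<Longrightarrow> 2 * n \<le> q (i + 1) k - q i k"
    unfolding eventually_sequentially by blast
  \<comment> \<open>\<open>LEAST\<close> is meaningful only if some index qualifies; divergence of
    the finitely many differences provides K.\<close>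
  have "enat (2 * n) \<le> gap l q K"
    unfolding gap_def using K by (intro INF_greatest) auto
  then have "enat (2 * n) \<le> gap l q (gap_time l q n)"
    unfolding gap_time_def by (rule LeastI)
  then have step: "2 * n \<le> q (j + 1) k - q j k" if "j \<in> {1..<l}" for j
  proof -
    assume le: "enat (2 * n) \<le> gap l q (gap_time l q n)"
    also have "\<dots> \<le> (INF i \<in> {1..<l}. enat (q (i + 1) k - q i k))"
      unfolding gap_def using k by (intro INF_lower) auto
    also have "\<dots> \<le> enat (q (j + 1) k - q j k)" using that by (intro INF_lower)
    finally show ?thesis by simp
  qed
  \<comment> \<open>The last of the consecutive steps alone provides 2 n; the earlier ones only must
    not decrease.\<close>
  have "i < i' \<Longrightarrow> i' \<le> l \<Longrightarrow> q i k + 2 * n \<le> q i' k"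
  proof (induction i')
    case (Suc j)
    then have "j \<in> {1..<l}" using i(1) by auto
    then have "q j k + 2 * n \<le> q (Suc j) k" using step[of j] q_less[of j k] k(1) by auto
    moreover have "q i k \<le> q j k" using Suc by (cases "i = j") auto
    ultimately show ?case by linarith
  qed simp
  then show ?thesis using i by blast
qed

section \<open>Collecting the error terms\<close>

theorem corollary2p2:
  fixes P :: "(nat \<Rightarrow> 'a :: countable) measure"
    and l :: nat and q :: "nat \<Rightarrow> nat \<Rightarrow> nat" and t \<Gamma> :: real
  assumes alphabet: "\<exists>a b :: 'a. a \<noteq> b"
    and prob: "prob_space P"
    and space_P: "space P = UNIV"
    and sets_P: "sets P = cylinder_algebra"
    and invariant: "distr P P left_shift = P"
    and pos_cyl: "\<And>a. measure P (cylinder [a]) > 0"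
    and l: "l \<ge> 1"
    and q_pos: "\<And>i k. i \<in> {1..l} \<Longrightarrow> k \<ge> 1 \<Longrightarrow> q i k > 0"
    and q_incr: "\<And>i. i \<in> {1..l} \<Longrightarrow> strict_mono_on {1..} (q i)"
    and q_less: "\<And>i k. i \<in> {1..<l} \<Longrightarrow> k \<ge> 1 \<Longrightarrow> q i k < q (i + 1) k"
    and q_gap: "\<And>i. i \<in> {1..<l} \<Longrightarrow> filterlim (\<lambda>k. q (i + 1) k - q i k) at_top at_top"
    and mixing: "psi_mixing P"
    and t: "t > 0"
    and \<Gamma>: "\<Gamma> > 0"
    and decay: "\<And>n A. n \<ge> 1 \<Longrightarrow> A \<in> cylinders n \<Longrightarrow> measure P A \<le> exp (- \<Gamma> * real n)"
  shows "AE \<omega> in P. \<exists>M::nat. \<forall>n\<ge>M.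
    (let A = cylinder_at \<omega> n;
         N = nat \<lfloor>t / measure P A ^ l\<rfloor>;
         \<gamma> = real (gap_time l q n);
         \<psi> = (\<lambda>m. enn2real (psi P m))
     in (SUP L :: nat set.
           \<bar>measure P {\<omega>' \<in> space P. hit_count l q A N \<omega>' \<in> L} - measure (poisson_pmf t) L\<bar>)
        \<le> 16 * exp (- \<Gamma> * real n) *
             (real l ^ 2 * real n * t + \<gamma> * (1 + 1 / t)
              + t * real l ^ 2 * real n ^ 4 * (1 + \<psi> 0))
          + 2 * wp (2 ^ l * t * \<psi> n + \<gamma> * exp (- \<Gamma> * real n)))"
proof -
  interpret prob_space P by (rule prob)
  interpret shift_invariant P by unfold_locales (rule space_P sets_P invariant)+
  define \<psi> where "\<psi> m = enn2real (psi P m)" for m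
  have \<psi>0: "\<psi> m \<ge> 0" for m by (simp add: \<psi>_def)
  have fin0: "psi P 0 < \<infinity>" and lim: "psi P \<longlonglongrightarrow> 0" using mixing by (auto simp: psi_mixing_def)
  have lim_\<psi>: "\<psi> \<longlonglongrightarrow> 0"
    using tendsto_enn2real[of "psi P" 0 sequentially] lim by (simp add: \<psi>_def[abs_def])
  have decay': "prob (cylinder bs) \<le> exp (- \<Gamma> * real (length bs))" if "length bs \<ge> 1" for bs :: "'a list"
    using decay[OF that, of "cylinder bs"] by (auto simp: cylinders_def)
  have fin_ev: "\<forall>\<^sub>F n in sequentially. psi P n < \<infinity>"
    using order_tendstoD(2)[OF lim, of \<infinity>] by simp
  \<comment> \<open>The condition 1 / (8 t) \<le> n is there to absorb the error e^(-\<Gamma> n)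
    from rounding N to an integer.\<close>
  have ev: "\<forall>\<^sub>F n in sequentially. n \<ge> 1 \<and> 1 / (8 * t) \<le> real n \<and> psi P n < \<infinity> \<and> \<psi> n < 1 \<and> 2 ^ (l + 1) * \<psi> n \<le> 1
    \<and> ((1 + \<psi> n)\<^sup>2 / (1 - \<psi> n)) ^ l \<le> 1 + 2 ^ (l + 1) * \<psi> n
    \<and> 1 - 2 ^ (l + 1) * \<psi> n \<le> ((1 - \<psi> n)\<^sup>2 / (1 + \<psi> n)) ^ l"
    using eventually_ge_at_top[of 1] eventually_ge_at_top[of "nat \<lceil>1 / (8 * t)\<rceil>"]
      fin_ev eventually_power_ratio_le[OF l \<psi>0 lim_\<psi>]
    by eventually_elim (auto simp: nat_ceiling_le_eq)
  have "AE \<omega> in P. \<forall>\<^sub>F n in sequentially. \<forall>d. 1 \<le> d \<longrightarrow> d < n \<longrightarrow>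
      (\<forall>i < n - d. \<omega> (i + d) = \<omega> i) \<longrightarrow> exp (\<Gamma> * real (n - d)) \<le> real n ^ 3"
    by (rule AE_no_short_period[OF fin0 decay'])
  then show ?thesis
    using AE_cylinder_at_pos
  proof eventually_elim
    case (elim \<omega>)
    from elim(1) ev have "\<forall>\<^sub>F n in sequentially.
      (SUP L :: nat set. \<bar>prob {\<omega>' \<in> space P. hit_count l q (cylinder_at \<omega> n)
          (nat \<lfloor>t / prob (cylinder_at \<omega> n) ^ l\<rfloor>) \<omega>' \<in> L} - measure (poisson_pmf t) L\<bar>)
        \<le> 16 * exp (- \<Gamma> * real n) * (real l ^ 2 * real n * t + real (gap_time l q n) * (1 + 1 / t)
              + t * real l ^ 2 * real n ^ 4 * (1 + \<psi> 0))
          + 2 * wp (2 ^ l * t * \<psi> n + real (gap_time l q n) * exp (- \<Gamma> * real n))"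
    proof eventually_elim
      case hyp: (elim n)
      define as where "as = map \<omega> [0..<n]"
      define p where "p = prob (cylinder as)"
      define N where "N = nat \<lfloor>t / p ^ l\<rfloor>"
      define \<gamma> where "\<gamma> = gap_time l q n"
      define E where "E = exp (- \<Gamma> * real n)"
      \<comment> \<open>The \<open>max\<close> excludes index 0, since \<gamma> may be 0 while
        \<open>q\<close> is controlled only for positive arguments.\<close>
      define I where "I = {max 1 \<gamma>..N}"
      define c where "c = 2 ^ (l + 1) * \<psi> n"
      \<comment> \<open>The bound for pairs with b = n^3 and with the estimate 2 p^l for a single
        hit.\<close>
      define r where "r = 2 * (1 + \<psi> 0) * p ^ l * (real n ^ 3 * E)"
      let ?X = "joint_block l q as"
      have n: "n \<ge> 1" and n_t: "1 / (8 * t) \<le> real n" and fin: "psi P n < \<infinity>" and e1: "\<psi> n < 1"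
        and c1: "c \<le> 1" and hi: "((1 + \<psi> n)\<^sup>2 / (1 - \<psi> n)) ^ l \<le> 1 + c"
        and lo: "1 - c \<le> ((1 - \<psi> n)\<^sup>2 / (1 + \<psi> n)) ^ l"
        using hyp(2) by (auto simp: c_def)
      have len: "length as = n" by (simp add: as_def)
      have A: "cylinder_at \<omega> n = cylinder as" by (simp add: cylinder_at_def as_def)
      have p0: "p > 0" using elim(2) unfolding p_def A[symmetric] by blast
      have pE: "p \<le> E" using decay'[of as] n by (simp add: p_def E_def len)
      have p1: "p \<le> 1" by (simp add: p_def)
      have pl: "0 < p ^ l" "p ^ l \<le> p" using p0 p1 l power_decreasing[of 1 l p] by auto
      have E0: "E > 0" by (simp add: E_def)
      have sep: "q i k + 2 * n \<le> q i' k" if "k \<in> I" "i \<in> {1..l}" "i' \<in> {1..l}" "i < i'" for k i i'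
        using that by (intro gap_time_separation[where q = q and l = l] q_less q_gap) (auto simp: I_def \<gamma>_def)
      have prob_X: "prob (?X k) \<le> p" for k
        unfolding p_def using l by (rule prob_joint_block_le)
      \<comment> \<open>Detaching the l blocks costs at most 1 + c \<le> 2.\<close>
      have prob_X2: "prob (?X k) \<le> 2 * p ^ l" if k: "k \<in> I" for k
      proof -
        have S: "finite {1..l}" "card {1..l} = l" by auto
        have U: "determined_by {} (UNIV :: (nat \<Rightarrow> 'a) set)" by (simp add: determined_by_def)
        have sep': "q i k + 2 * length as \<le> q i' k \<or> q i' k + 2 * length as \<le> q i k"
          if "i \<in> {1..l}" "i' \<in> {1..l}" "i \<noteq> i'" for i i'
          using sep[OF k that(1,2)] sep[OF k that(2,1)] that(3) unfolding len by linarith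
        have "prob (?X k) \<le> ((1 + \<psi> n)\<^sup>2 / (1 - \<psi> n)) ^ l * p ^ l * prob UNIV"
          using blocks_interlaced(1)[of as "{}" UNIV "{1..l}" "\<lambda>i. q i k", OF _ _ _ U S(1) _ sep']
            fin e1 S(2) unfolding joint_block_def p_def \<psi>_def len by auto
        also have "\<dots> = ((1 + \<psi> n)\<^sup>2 / (1 - \<psi> n)) ^ l * p ^ l"
          using prob_space by (simp add: space_P)
        also have "\<dots> \<le> 2 * p ^ l"
          using hi c1 pl by (intro mult_right_mono) auto
        finally show ?thesis .
      qed
      have per: "exp (\<Gamma> * real (length as - d)) \<le> real n ^ 3"
        if d: "1 \<le> d" "d < length as" "\<And>i. i < length as - d \<Longrightarrow> as ! (i + d) = as ! i" for d
      proof -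
        have "\<omega> (i + d) = \<omega> i" if i: "i < n - d" for i
          using d(3)[of i] i by (simp add: as_def)
        then show ?thesis using hyp(1) d(1,2) by (simp add: len)
      qed
      have n3: "real n ^ 3 \<ge> 1" using n by simp
      have pair_lt: "prob (?X k \<inter> ?X j) \<le> r" if "k \<in> I" "j \<in> I" "k < j" for k j
      proof -
        have lt: "q l k < q l j"
          using q_incr[of l] l that by (auto simp: strict_mono_on_def I_def)
        have ql: "q i k \<le> q l k" if "i \<in> {1..<l}" for i
          using sep[OF \<open>k \<in> I\<close>, of i l] that by auto
        have "prob (?X k \<inter> ?X j)
            \<le> (1 + enn2real (psi P 0)) * prob (?X k) * (real n ^ 3 * exp (- \<Gamma> * real (length as)))"
          using n by (intro prob_two_joint_blocks[where q = q and l = l] l fin0 decay' per n3 ql lt) (auto simp: len)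
        then have "prob (?X k \<inter> ?X j) \<le> (1 + \<psi> 0) * prob (?X k) * (real n ^ 3 * E)"
          unfolding len \<psi>_def E_def .
        also have "\<dots> \<le> (1 + \<psi> 0) * (2 * p ^ l) * (real n ^ 3 * E)"
          using prob_X2[OF that(1)] \<psi>0[of 0] E0 by (intro mult_right_mono mult_left_mono) auto
        finally show ?thesis by (simp add: r_def algebra_simps)
      qed
      have pair: "prob (?X k \<inter> ?X j) \<le> r" if "k \<in> I" "j \<in> I" "k \<noteq> j" for k j
        using pair_lt[of k j] pair_lt[of j k] that by (cases "k < j") (auto simp: Int_commute)
      have r0: "r \<ge> 0" using \<psi>0[of 0] p0 E0 by (simp add: r_def)
      have inj: "inj_on (q i) I" if "i \<in> {1..l}" for i
        using strict_mono_on_imp_inj_on[OF q_incr[OF that]] by (rule inj_on_subset) (auto simp: I_def)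
      define m where "m = real (card I)"
      \<comment> \<open>Rounding loses at most one index and dropping the early ones at most
        \<gamma>; each contributes p^l \<le> p.\<close>
      have m: "m * p ^ l \<le> t" "t \<le> m * p ^ l + (real \<gamma> + 1) * p"
      proof -
        have N: "real N \<le> t / p ^ l" "t / p ^ l \<le> real N + 1"
          using t pl(1) by (auto simp: N_def)
        have "m \<le> real N" "real N \<le> m + real \<gamma>" unfolding m_def I_def by auto
        then have b: "m \<le> t / p ^ l" "t / p ^ l \<le> m + real \<gamma> + 1" using N by linarith+
        show "m * p ^ l \<le> t" using b(1) pl by (simp add: field_simps)
        have "t \<le> (m + real \<gamma> + 1) * p ^ l" using b(2) pl by (simp add: field_simps)
        also have "\<dots> = m * p ^ l + (real \<gamma> + 1) * p ^ l" by (simp add: algebra_simps)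
        also have "\<dots> \<le> m * p ^ l + (real \<gamma> + 1) * p" using pl by (intro add_left_mono mult_left_mono) auto
        finally show "t \<le> m * p ^ l + (real \<gamma> + 1) * p" .
      qed
      have bound: "\<bar>prob {\<omega>' \<in> space P. hit_count l q (cylinder as) N \<omega>' \<in> L} - measure (poisson_pmf t) L\<bar>
        \<le> 16 * E * (real l ^ 2 * real n * t + real \<gamma> * (1 + 1 / t) + t * real l ^ 2 * real n ^ 4 * (1 + \<psi> 0))
          + 2 * wp (2 ^ l * t * \<psi> n + real \<gamma> * E)" for L
      proof -
        let ?V = "{\<omega>'. card {k \<in> I. \<omega>' \<in> ?X k} \<in> L}"
        let ?U = "{\<omega>'. card {k \<in> {1..N}. \<omega>' \<in> ?X k} \<in> L}"
        \<comment> \<open>Outside the event of an early hit, the counts over {1..N} and over I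
          coincide.\<close>
        let ?D = "\<Union>k\<in>{1..<\<gamma>}. ?X k"
        have main: "\<bar>prob ?V - measure (poisson_pmf t) L\<bar>
            \<le> \<bar>t - m * p ^ l\<bar> + m * (c * p ^ l) + 2 * (m * (4 * real n * (real l)\<^sup>2 * (p ^ l * p + r)))"
          unfolding m_def p_def
          using poisson_joint_block[where as = as and l = l and t = t and c = c and I = I and q = q and r = r and L = L]
            n l t fin e1 hi lo sep inj pair r0 unfolding len \<psi>_def by (auto simp: I_def)
        have D: "prob ?D \<le> real \<gamma> * E"
        proof -
          have "prob ?D \<le> (\<Sum>k\<in>{1..<\<gamma>}. prob (?X k))"
            using joint_block_events by (intro finite_measure_subadditive_finite) auto
          also have "\<dots> \<le> (\<Sum>k\<in>{1..<\<gamma>}. E)" using prob_X pE by (intro sum_mono) (rule order_trans)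
          also have "\<dots> \<le> real \<gamma> * E" using E0 by simp
          finally show ?thesis .
        qed
        have same: "{k \<in> {1..N}. x \<in> ?X k} = {k \<in> I. x \<in> ?X k}" if "x \<notin> ?D" for x
          using that by (auto simp: I_def)
        have ev: "{\<omega>'. card {k \<in> K. \<omega>' \<in> ?X k} \<in> L} \<in> events" if "finite K" for K
          using that by (intro determined_by_events[OF _ determined_by_card_joint_block]) auto
        have D_ev: "?D \<in> events" using joint_block_events by auto
        have UV: "?U \<subseteq> ?V \<union> ?D" "?V \<subseteq> ?U \<union> ?D" using same by fastforce+
        have UV_ev: "?U \<in> events" "?V \<in> events" by (rule ev, simp add: I_def)+
        have "prob ?U \<le> prob ?V + prob ?D"
          by (rule order_trans[OF finite_measure_mono[OF UV(1)] measure_Un_le])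
            (use UV_ev D_ev in blast)+
        moreover have "prob ?V \<le> prob ?U + prob ?D"
          by (rule order_trans[OF finite_measure_mono[OF UV(2)] measure_Un_le])
            (use UV_ev D_ev in blast)+
        ultimately have "\<bar>prob ?U - measure (poisson_pmf t) L\<bar> \<le> real \<gamma> * E + \<bar>prob ?V - measure (poisson_pmf t) L\<bar>"
          using D by linarith
        also note main
        also have "\<bar>t - m * p ^ l\<bar> \<le> (real \<gamma> + 1) * E"
        proof -
          have "(real \<gamma> + 1) * p \<le> (real \<gamma> + 1) * E" using pE by (intro mult_left_mono) auto
          then show ?thesis using m by linarith
        qed
        also have "m * (c * p ^ l) \<le> 2 * (2 ^ l * t * \<psi> n)"
        proof -
          have "c * (m * p ^ l) \<le> c * t" using m \<psi>0[of n] by (intro mult_left_mono) (auto simp: c_def)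
          then show ?thesis by (simp add: c_def ac_simps)
        qed
        \<comment> \<open>One factor p^l is taken out of both terms and combined with m to give at
          most t. The n^3 from the periods times the n from the neighbourhoods yields n^4.\<close>
        also have "m * (4 * real n * (real l)\<^sup>2 * (p ^ l * p + r))
            \<le> 4 * real n * (real l)\<^sup>2 * (t * (E + 2 * (1 + \<psi> 0) * (real n ^ 3 * E)))"
        proof -
          have "m * (p ^ l * p + r) = (m * p ^ l) * (p + 2 * (1 + \<psi> 0) * (real n ^ 3 * E))"
            by (simp add: r_def algebra_simps)
          also have "\<dots> \<le> t * (E + 2 * (1 + \<psi> 0) * (real n ^ 3 * E))"
            using m pE p0 t E0 \<psi>0[of 0] by (intro mult_mono add_mono) auto
          finally have "m * (p ^ l * p + r) \<le> t * (E + 2 * (1 + \<psi> 0) * (real n ^ 3 * E))" .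
          then show ?thesis
            unfolding mult.left_commute[of m "4 * real n * (real l)\<^sup>2"] by (intro mult_left_mono) auto
        qed
        finally have 1: "\<bar>prob ?U - measure (poisson_pmf t) L\<bar>
          \<le> real \<gamma> * E + ((real \<gamma> + 1) * E + 2 * (2 ^ l * t * \<psi> n)
            + 2 * (4 * real n * (real l)\<^sup>2 * (t * (E + 2 * (1 + \<psi> 0) * (real n ^ 3 * E)))))"
          by simp
        \<comment> \<open>The main term 8 n l^2 t E is only half of what the claim allows; the other
          half takes the rounding error.\<close>
        have 2: "E \<le> 8 * real n * (real l)\<^sup>2 * t * E"
        proof -
          have "1 \<le> 8 * real n * t" using n_t t by (simp add: field_simps)
          moreover have "1 \<le> (real l)\<^sup>2" using l by simp
          ultimately have "1 * 1 \<le> (8 * real n * t) * (real l)\<^sup>2" using t by (intro mult_mono) auto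
          then have "1 * E \<le> (8 * real n * t * (real l)\<^sup>2) * E" using E0 by (intro mult_right_mono) auto
          then show ?thesis by (simp add: ac_simps)
        qed
        \<comment> \<open>One \<gamma> E comes from the early hits, the other from the defect of m
          p^l against t.\<close>
        have 3: "2 * (real \<gamma> * E) \<le> 16 * E * (real \<gamma> * (1 + 1 / t))"
        proof -
          have "2 * 1 \<le> 16 * (1 + 1 / t)" using t by (intro mult_mono) auto
          then have "2 * 1 * (real \<gamma> * E) \<le> 16 * (1 + 1 / t) * (real \<gamma> * E)"
            using E0 by (intro mult_right_mono) auto
          then show ?thesis by (simp only: ac_simps mult_1)
        qed
        \<comment> \<open>For x \<ge> 0 the exponential factor of \<open>wp x\<close> is at least 1
          and is given away.\<close>
        have 4: "2 ^ l * t * \<psi> n \<le> wp (2 ^ l * t * \<psi> n + real \<gamma> * E)"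
        proof -
          let ?x = "2 ^ l * t * \<psi> n + real \<gamma> * E"
          have "?x \<ge> 0" using t \<psi>0[of n] E0 by simp
          then have "?x * 1 \<le> wp ?x" unfolding wp_def by (intro mult_left_mono) auto
          moreover have "2 ^ l * t * \<psi> n \<le> ?x" using E0 by simp
          ultimately show ?thesis by (simp only: mult_1_right)
        qed
        have "real \<gamma> * E + ((real \<gamma> + 1) * E + 2 * (2 ^ l * t * \<psi> n)
            + 2 * (4 * real n * (real l)\<^sup>2 * (t * (E + 2 * (1 + \<psi> 0) * (real n ^ 3 * E)))))
          = 2 * (real \<gamma> * E) + E + 8 * real n * (real l)\<^sup>2 * t * E
            + 16 * E * (t * real l ^ 2 * real n ^ 4 * (1 + \<psi> 0)) + 2 * (2 ^ l * t * \<psi> n)"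
          by (simp add: algebra_simps power4_eq_xxxx power3_eq_cube)
        also have "\<dots> \<le> 16 * E * (real \<gamma> * (1 + 1 / t)) + 16 * E * (real l ^ 2 * real n * t)
            + 16 * E * (t * real l ^ 2 * real n ^ 4 * (1 + \<psi> 0)) + 2 * wp (2 ^ l * t * \<psi> n + real \<gamma> * E)"
        proof -
          have "16 * E * (real l ^ 2 * real n * t) = 2 * (8 * real n * (real l)\<^sup>2 * t * E)" by simp
          then show ?thesis using 2 3 4 by linarith
        qed
        also have "\<dots> = 16 * E * (real l ^ 2 * real n * t + real \<gamma> * (1 + 1 / t)
              + t * real l ^ 2 * real n ^ 4 * (1 + \<psi> 0)) + 2 * wp (2 ^ l * t * \<psi> n + real \<gamma> * E)"
          by (simp only: distrib_left add.commute add.left_commute)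
        finally show ?thesis using 1 by (simp add: hit_count_cylinder space_P)
      qed
      \<comment> \<open>The bound does not depend on L, so it passes to the supremum over the
        nonempty family of all L.\<close>
      show ?case
        using bound unfolding A N_def p_def \<gamma>_def E_def by (intro cSUP_least) auto
    qed
    then show ?case unfolding Let_def \<psi>_def eventually_sequentially .
  qed
qed

end
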